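(* Matrices $A^{ij}=\begin{pmatrix} b^{ij} & a^{ij}\\ c^{ij} & b^{ij}\end{pmatrix}$ assigned to the plaquettes $\sigma^{ij}(n)=(n,n+e_i,n+e_i+e_j,n+e_j)$ in $\mathbb Z^N$ serve as coefficients of a consistent system of vector Moutard equations $$\begin{pmatrix}u_{ij}-u\\ v_{ij}-v\end{pmatrix}=A^{ij}\begin{pmatrix}u_i-u_j\\ v_i-v_j\end{pmatrix}$$ if and only if their entries satisfy $$\lambda a^{ij}+\mu(-1)^{|n|}b^{ij}+\nu c^{ij}=0$$ for some fixed triple $(\lambda,\mu,\nu)\neq(0,0,0)$, where $|n|=n_1+\dots+n_N$, and their evolution is expressed (in the generic case, when $\lambda,\nu\neq 0$) through a solution of the coupled star-triangle relations $$\frac{1}{p^{ij}_k}=\frac{\lambda}{\nu}\cdot\frac{q^{ij}q^{jk}+q^{jk}q^{ki}+q^{ki}q^{ij}}{q^{ij}},\qquad \frac{1}{q^{ij}_k}=\frac{\lambda}{\nu}\cdot\frac{p^{ij}p^{jk}+p^{jk}p^{ki}+p^{ki}p^{ij}}{p^{ij}},$$ via the following relations: $$p^{ij}=a^{ij}+\xi b^{ij},\qquad q^{ij}=a^{ij}+\eta b^{ij},$$ and $$p^{ij}_k=a^{ij}_k-\xi b^{ij}_k,\qquad q^{ij}_k=a^{ij}_k-\eta b^{ij}_k,$$ where $-\xi$, $-\eta$ are the two roots $x$ of the quadratic equation $\lambda x^2+\mu x+\nu=0$.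
   Context: Notation on the lattice: $n=(n_1,\dots,n_N)\in\mathbb Z^N$ and $e_i$ is the $i$-th coordinate vector. Subscripts on the fields $u,v$ denote shifts: $u=u(n)$, $u_i=u(n+e_i)$, $u_{ij}=u(n+e_i+e_j)$, etc. Quantities with double superscript $ij$ are attached to the plaquette $\sigma^{ij}(n)$ and depend on the plaquette; an additional subscript $k$ means that the quantity is attached to the shifted plaquette $\sigma^{ij}(n+e_k)$, so that $a^{ij}_k,b^{ij}_k$ are the entries of the matrix on $\sigma^{ij}(n+e_k)$. Since the equation on a plaquette does not depend on the order of $i,j$, one has $A^{ji}=-A^{ij}$. Consistency of the system of vector Moutard equations: for every elementary 3D cube of $\mathbb Z^N$ (with base point $n$ and pairwise distinct directions $i,j,k$), arbitrary initial data $(u,v),(u_i,v_i),(u_j,v_j),(u_k,v_k)$ can be extended to fields $(u,v)$ at all eight vertices of the cube so that the vector Moutard equation is fulfilled on all six faces. Evolution means the map which sends the coefficients on the three plaquettes $\sigma^{ij}(n),\sigma^{jk}(n),\sigma^{ki}(n)$ of an elementary cube to the coefficients on the three opposite plaquettes $\sigma^{ij}(n+e_k),\sigma^{jk}(n+e_i),\sigma^{ki}(n+e_j)$; the formulas are to be read with all cyclic permutations of $(i,j,k)$.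
   Formalization: Complex A^{ij}, all invertible; p=a+(-1)^{|n|}ξb, likewise q; "if" needs λν≠0 and ξ≠η; for one triple on all of Z^N, "only if" assumes that relations on the three plaquettes at one corner hold on the coordinate planes through it (per cube, no such assumption). *)

theory Defs
  imports "HOL-Analysis.Analysis"
begin

text \<open>
  The lattice is \<^typ>\<open>int ^ 'n\<close>. A plaquette quantity is a function of the base point and of an ordered
  pair of directions; its values for equal directions are irrelevant. Coefficients and fields are
  complex, so that the quadratic equation below always has its roots.
\<close>

type_synonym 'n plaq = "int ^ 'n \<Rightarrow> 'n \<Rightarrow> 'n \<Rightarrow> complex"

definition e :: "'n::finite \<Rightarrow> int ^ 'n" where
  "e i = axis i 1"

definition parity_sign :: "int ^ 'n::finite \<Rightarrow> complex" where
  "parity_sign n = (- 1) powi (\<Sum>l\<in>UNIV. n $ l)"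

definition coeff_matrix ::
  "'n plaq \<Rightarrow> 'n plaq \<Rightarrow> 'n plaq \<Rightarrow> int ^ 'n::finite \<Rightarrow> 'n \<Rightarrow> 'n \<Rightarrow> complex ^ 2 ^ 2" where
  "coeff_matrix a b c n i j = vector [vector [b n i j, a n i j], vector [c n i j, b n i j]]"

definition moutard ::
  "'n plaq \<Rightarrow> 'n plaq \<Rightarrow> 'n plaq \<Rightarrow> (int ^ 'n \<Rightarrow> complex) \<Rightarrow> (int ^ 'n \<Rightarrow> complex)
    \<Rightarrow> int ^ 'n::finite \<Rightarrow> 'n \<Rightarrow> 'n \<Rightarrow> bool" where
  "moutard a b c u v n i j \<longleftrightarrow>
     (vector [u (n + e i + e j) - u n, v (n + e i + e j) - v n] :: complex ^ 2) =
       coeff_matrix a b c n i j *v vector [u (n + e i) - u (n + e j), v (n + e i) - v (n + e j)]"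

text \<open>Only the values of \<open>u\<close> and \<open>v\<close> at the eight vertices of the cube matter.\<close>

definition cube_consistent ::
  "'n plaq \<Rightarrow> 'n plaq \<Rightarrow> 'n plaq \<Rightarrow> int ^ 'n::finite \<Rightarrow> 'n \<Rightarrow> 'n \<Rightarrow> 'n \<Rightarrow> bool" where
  "cube_consistent a b c n i j k \<longleftrightarrow>
     (\<forall>u0 v0 ui vi uj vj uk vk. \<exists>u v.
        u n = u0 \<and> v n = v0 \<and> u (n + e i) = ui \<and> v (n + e i) = vi \<and>
        u (n + e j) = uj \<and> v (n + e j) = vj \<and> u (n + e k) = uk \<and> v (n + e k) = vk \<and>
        moutard a b c u v n i j \<and> moutard a b c u v (n + e k) i j \<and>
        moutard a b c u v n j k \<and> moutard a b c u v (n + e i) j k \<and>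
        moutard a b c u v n k i \<and> moutard a b c u v (n + e j) k i)"

definition consistent :: "'n plaq \<Rightarrow> 'n plaq \<Rightarrow> 'n::finite plaq \<Rightarrow> bool" where
  "consistent a b c \<longleftrightarrow>
     (\<forall>n i j k. distinct [i, j, k] \<longrightarrow> cube_consistent a b c n i j k)"

definition lin_rel ::
  "'n plaq \<Rightarrow> 'n plaq \<Rightarrow> 'n plaq \<Rightarrow> complex \<Rightarrow> complex \<Rightarrow> complex
    \<Rightarrow> int ^ 'n::finite \<Rightarrow> 'n \<Rightarrow> 'n \<Rightarrow> bool" where
  "lin_rel a b c lam \<mu> \<nu> n i j \<longleftrightarrow>
     lam * a n i j + \<mu> * parity_sign n * b n i j + \<nu> * c n i j = 0"

definition lin_rel_base ::
  "'n plaq \<Rightarrow> 'n plaq \<Rightarrow> 'n plaq \<Rightarrow> complex \<Rightarrow> complex \<Rightarrow> complex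
    \<Rightarrow> int ^ 'n::finite \<Rightarrow> 'n \<Rightarrow> 'n \<Rightarrow> 'n \<Rightarrow> bool" where
  "lin_rel_base a b c lam \<mu> \<nu> n i j k \<longleftrightarrow>
     lin_rel a b c lam \<mu> \<nu> n i j \<and> lin_rel a b c lam \<mu> \<nu> n j k \<and> lin_rel a b c lam \<mu> \<nu> n k i"

definition lin_rel_cube ::
  "'n plaq \<Rightarrow> 'n plaq \<Rightarrow> 'n plaq \<Rightarrow> complex \<Rightarrow> complex \<Rightarrow> complex
    \<Rightarrow> int ^ 'n::finite \<Rightarrow> 'n \<Rightarrow> 'n \<Rightarrow> 'n \<Rightarrow> bool" where
  "lin_rel_cube a b c lam \<mu> \<nu> n i j k \<longleftrightarrow>
     lin_rel_base a b c lam \<mu> \<nu> n i j k \<and>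
     lin_rel a b c lam \<mu> \<nu> (n + e k) i j \<and>
     lin_rel a b c lam \<mu> \<nu> (n + e i) j k \<and>
     lin_rel a b c lam \<mu> \<nu> (n + e j) k i"

text \<open>With multiplicity: if the root is double, then \<open>\<xi> = \<eta>\<close>.\<close>

definition minus_roots :: "complex \<Rightarrow> complex \<Rightarrow> complex \<Rightarrow> complex \<Rightarrow> complex \<Rightarrow> bool" where
  "minus_roots lam \<mu> \<nu> \<xi> \<eta> \<longleftrightarrow> {x. lam * x\<^sup>2 + \<mu> * x + \<nu> = 0} = {- \<xi>, - \<eta>}"

text \<open>
  The linear relation at \<open>n\<close> has middle coefficient \<open>\<mu> (-1)\<^bsup>|n|\<^esup>\<close>, so at odd points \<open>\<xi>\<close> and \<open>\<eta>\<close> change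
  sign. At an even point \<open>n\<close> the value of \<open>shifted_coeff\<close> is \<open>a + \<xi> b\<close>, and at \<open>n + e k\<close> it
  is \<open>a - \<xi> b\<close>.
\<close>

definition shifted_coeff :: "complex \<Rightarrow> 'n plaq \<Rightarrow> 'n plaq \<Rightarrow> 'n::finite plaq" where
  "shifted_coeff \<xi> a b n i j = a n i j + parity_sign n * \<xi> * b n i j"

definition half_star_triangle ::
  "complex \<Rightarrow> 'n plaq \<Rightarrow> 'n plaq \<Rightarrow> int ^ 'n::finite \<Rightarrow> 'n \<Rightarrow> 'n \<Rightarrow> 'n \<Rightarrow> bool" where
  "half_star_triangle \<kappa> p q n i j k \<longleftrightarrow>
     1 / p (n + e k) i j =
       \<kappa> * ((q n i j * q n j k + q n j k * q n k i + q n k i * q n i j) / q n i j)"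

definition coupled_star_triangle ::
  "complex \<Rightarrow> 'n plaq \<Rightarrow> 'n plaq \<Rightarrow> int ^ 'n::finite \<Rightarrow> 'n \<Rightarrow> 'n \<Rightarrow> 'n \<Rightarrow> bool" where
  "coupled_star_triangle \<kappa> p q n i j k \<longleftrightarrow>
     (\<forall>(i', j', k') \<in> {(i, j, k), (j, k, i), (k, i, j)}.
        half_star_triangle \<kappa> p q n i' j' k' \<and> half_star_triangle \<kappa> q p n i' j' k')"

definition evolves ::
  "'n plaq \<Rightarrow> 'n plaq \<Rightarrow> complex \<Rightarrow> complex \<Rightarrow> complex \<Rightarrow> complex
    \<Rightarrow> int ^ 'n::finite \<Rightarrow> 'n \<Rightarrow> 'n \<Rightarrow> 'n \<Rightarrow> bool" where
  "evolves a b lam \<nu> \<xi> \<eta> n i j k \<longleftrightarrow>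
     coupled_star_triangle (lam / \<nu>) (shifted_coeff \<xi> a b) (shifted_coeff \<eta> a b) n i j k"

text \<open>
  If \<open>lam\<close> and \<open>\<nu>\<close> are nonzero, the linear relation makes \<open>p q\<close> a nonzero multiple of the determinant
  of the coefficient matrix. So for invertible matrices no \<open>p\<close> or \<open>q\<close> in a denominator vanishes.
\<close>

definition governed_cube ::
  "'n plaq \<Rightarrow> 'n plaq \<Rightarrow> 'n plaq \<Rightarrow> complex \<Rightarrow> complex \<Rightarrow> complex
    \<Rightarrow> int ^ 'n::finite \<Rightarrow> 'n \<Rightarrow> 'n \<Rightarrow> 'n \<Rightarrow> bool" where
  "governed_cube a b c lam \<mu> \<nu> n i j k \<longleftrightarrow>
     (lam, \<mu>, \<nu>) \<noteq> (0, 0, 0) \<and> lin_rel_cube a b c lam \<mu> \<nu> n i j k \<and>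
     (lam \<noteq> 0 \<and> \<nu> \<noteq> 0 \<longrightarrow>
        (\<exists>\<xi> \<eta>. minus_roots lam \<mu> \<nu> \<xi> \<eta> \<and> evolves a b lam \<nu> \<xi> \<eta> n i j k))"

definition governed ::
  "'n plaq \<Rightarrow> 'n plaq \<Rightarrow> 'n::finite plaq \<Rightarrow> complex \<Rightarrow> complex \<Rightarrow> complex \<Rightarrow> bool" where
  "governed a b c lam \<mu> \<nu> \<longleftrightarrow>
     (lam, \<mu>, \<nu>) \<noteq> (0, 0, 0) \<and>
     (\<forall>n i j. i \<noteq> j \<longrightarrow> lin_rel a b c lam \<mu> \<nu> n i j) \<and>
     (lam \<noteq> 0 \<and> \<nu> \<noteq> 0 \<longrightarrow>
        (\<exists>\<xi> \<eta>. minus_roots lam \<mu> \<nu> \<xi> \<eta> \<and>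
           (\<forall>n i j k. distinct [i, j, k] \<longrightarrow> evolves a b lam \<nu> \<xi> \<eta> n i j k)))"

text \<open>
  If \<open>\<xi> = \<eta>\<close> then \<open>p = q\<close> and the star-triangle relations leave one entry of every new matrix
  undetermined, so a double root has to be excluded too if they are to imply consistency.
\<close>

definition generic_triple :: "complex \<Rightarrow> complex \<Rightarrow> complex \<Rightarrow> bool" where
  "generic_triple lam \<mu> \<nu> \<longleftrightarrow> lam \<noteq> 0 \<and> \<nu> \<noteq> 0 \<and> \<mu>\<^sup>2 \<noteq> 4 * lam * \<nu>"

definition generic_coeffs :: "'n plaq \<Rightarrow> 'n plaq \<Rightarrow> 'n::finite plaq \<Rightarrow> bool" where
  "generic_coeffs a b c \<longleftrightarrow>
     (\<forall>lam \<mu> \<nu>. (lam, \<mu>, \<nu>) \<noteq> (0, 0, 0) \<and> (\<forall>n i j. i \<noteq> j \<longrightarrow> lin_rel a b c lam \<mu> \<nu> n i j)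
        \<longrightarrow> generic_triple lam \<mu> \<nu>)"

text \<open>
  Every linear relation satisfied on the three plaquettes at one corner \<open>m\<close> is satisfied on all
  plaquettes of the coordinate planes through \<open>m\<close>, which carry the initial data of the evolution.
  Nothing is required if the three plaquettes at \<open>m\<close> satisfy no nontrivial relation.
  Without such a condition different cubes may have different triples: if the coefficients on the
  plaquettes \<open>\<sigma>\<^sup>1\<^sup>2\<close> in a layer are multiples of one matrix (up to the parity sign), then a system
  with one triple below the layer and a system with another triple above it can be glued together,
  and the result is still consistent.
\<close>

definition uniform_initial_data ::
  "'n plaq \<Rightarrow> 'n plaq \<Rightarrow> 'n plaq \<Rightarrow> int ^ 'n::finite \<Rightarrow> 'n \<Rightarrow> 'n \<Rightarrow> 'n \<Rightarrow> bool" where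
  "uniform_initial_data a b c m i0 j0 k0 \<longleftrightarrow>
     (\<forall>lam \<mu> \<nu>. lin_rel_base a b c lam \<mu> \<nu> m i0 j0 k0 \<longrightarrow>
        (\<forall>n i j. i \<noteq> j \<and> (\<forall>l. l \<noteq> i \<and> l \<noteq> j \<longrightarrow> n $ l = m $ l) \<longrightarrow> lin_rel a b c lam \<mu> \<nu> n i j))"

end

theory Submission
  imports Defs
begin

text \<open>
  Let \<open>A, B, C\<close> be the matrices of the three plaquettes at the base point of a cube and \<open>A', B', C'\<close> those of
  the opposite plaquettes. Eliminating the intermediate fields, consistency becomes
  \<open>A' B = B' A\<close>, \<open>B' C = C' B\<close>, \<open>C' A = A' C\<close>, \<open>A' B + B' C + C' A = - 1\<close>. The first three equations give
  \<open>B A\<^sup>-\<^sup>1 C = C A\<^sup>-\<^sup>1 B\<close>, which for matrices with equal diagonal entries means linear dependence; this is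
  the linear relation at the base. The last one gives \<open>- A'\<^sup>-\<^sup>1 = B + C + B A\<^sup>-\<^sup>1 C\<close>, which lies in the same
  plane of matrices, and inversion changes the sign of \<open>\<mu>\<close>. Since the equations are also invariant under
  reversing a direction, the relation spreads from any corner of a cube to the whole cube, hence from the
  coordinate planes to the lattice.

  Take \<open>n\<close> even. Every matrix of the plane maps the row vectors \<open>(1, \<xi>)\<close> and \<open>(1, \<eta>)\<close> to \<open>p (- 1 / \<eta>, 1)\<close> and
  \<open>q (- 1 / \<xi>, 1)\<close>; at \<open>n + e k\<close> the same holds with \<open>- \<xi>\<close>, \<open>- \<eta>\<close>. Hence multiplying the four matrix equations
  by \<open>(1, - \<xi>)\<close> and \<open>(1, - \<eta>)\<close> turns them into scalar equations in \<open>p', q\<close> and in \<open>q', p\<close>, equivalent to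
  the star-triangle relations.
\<close>

section \<open>Two-by-two matrix algebra\<close>

lemma matrix_add_rdistrib: "(A + B) ** C = A ** C + B ** (C :: 'a::semiring_1^'n^'m)"
  by (simp add: matrix_matrix_mult_def vec_eq_iff sum.distrib distrib_right)

lemma matrix_mul_lneg: "(- A) ** B = - (A ** (B :: 'a::ring_1^'n^'m))"
  by (simp add: matrix_matrix_mult_def vec_eq_iff sum_negf)

lemma matrix_mul_rneg: "A ** (- B) = - (A ** (B :: 'a::ring_1^'n^'m))"
  by (simp add: matrix_matrix_mult_def vec_eq_iff sum_negf)

lemma invertible_cancel_left:
  assumes "invertible M" "M ** X = M ** Y"
  shows "X = Y"
  using assms unfolding invertible_def by (metis matrix_mul_assoc matrix_mul_lid)

lemma matrix_2_eq_iff: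
  "M = N \<longleftrightarrow> M$1$1 = N$1$1 \<and> M$1$2 = N$1$2 \<and> M$2$1 = N$2$1 \<and> M$2$2 = N$2$2"
  for M N :: "'a^2^2"
  by (auto simp: vec_eq_iff forall_2)

lemma matrix_mul_2: "(M ** N)$x$y = M$x$1 * N$1$y + M$x$2 * N$2$y"
  for M :: "'a::semiring_1^2^2"
  by (simp add: matrix_matrix_mult_def sum_2)

lemma invertible_2_iff: "invertible M \<longleftrightarrow> M$1$1 * M$2$2 - M$1$2 * M$2$1 \<noteq> 0"
  for M :: "'a::field^2^2"
  by (simp add: invertible_det_nz det_2)

text \<open>The inverse is the adjugate scaled by \<open>d\<close>, the determinant of
  \<open>N\<close>. Naming this scalar instead of dividing by the determinant of \<open>M\<close>
  keeps the later identities polynomial, within reach of \<open>algebra\<close>.\<close>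

lemma right_inverse_2:
  fixes M N :: "'a::field^2^2"
  assumes "M ** N = mat 1"
  obtains d where "d \<noteq> 0" "N$1$1 = d * M$2$2" "N$1$2 = - d * M$1$2"
    "N$2$1 = - d * M$2$1" "N$2$2 = d * M$1$1"
proof -
  define d where "d = N$1$1 * N$2$2 - N$1$2 * N$2$1"
  have eqs: "M$1$1 * N$1$1 + M$1$2 * N$2$1 = 1" "M$1$1 * N$1$2 + M$1$2 * N$2$2 = 0"
    "M$2$1 * N$1$1 + M$2$2 * N$2$1 = 0" "M$2$1 * N$1$2 + M$2$2 * N$2$2 = 1"
    using assms by (simp_all add: matrix_2_eq_iff matrix_mul_2 mat_def)
  have "d * (M$1$1 * M$2$2 - M$1$2 * M$2$1) = 1"
    unfolding d_def using eqs by algebra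
  then have "d \<noteq> 0" by auto
  moreover have "N$1$1 = d * M$2$2" "N$1$2 = - d * M$1$2"
    "N$2$1 = - d * M$2$1" "N$2$2 = d * M$1$1"
    unfolding d_def using eqs by algebra+
  ultimately show ?thesis by (rule that)
qed

section \<open>The plane of matrices cut out by a linear relation\<close>

definition pencil :: "'a::field \<Rightarrow> 'a \<Rightarrow> 'a \<Rightarrow> ('a^2^2) set" where
  "pencil l m v = {M. M$1$1 = M$2$2 \<and> l * M$1$2 + m * M$1$1 + v * M$2$1 = 0}"

lemma pencil_add:
  assumes "M \<in> pencil l m v" "N \<in> pencil l m v"
  shows "M + N \<in> pencil l m v"
proof -
  have "l * (M + N)$1$2 + m * (M + N)$1$1 + v * (M + N)$2$1 =
      (l * M$1$2 + m * M$1$1 + v * M$2$1) + (l * N$1$2 + m * N$1$1 + v * N$2$1)"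
    by (simp add: algebra_simps)
  moreover have "(M + N)$1$1 = (M + N)$2$2"
    using assms by (simp add: pencil_def)
  ultimately show ?thesis using assms unfolding pencil_def mem_Collect_eq by (metis add_0)
qed

lemma pencil_uminus:
  assumes "M \<in> pencil l m v"
  shows "- M \<in> pencil l m v"
proof -
  have "l * (- M)$1$2 + m * (- M)$1$1 + v * (- M)$2$1 = - (l * M$1$2 + m * M$1$1 + v * M$2$1)"
    by (simp add: algebra_simps)
  moreover have "(- M)$1$1 = (- M)$2$2"
    using assms by (simp add: pencil_def)
  ultimately show ?thesis using assms unfolding pencil_def mem_Collect_eq by (metis minus_zero)
qed

text \<open>Up to a factor, inversion keeps the two equal diagonal entries and negates the
  off-diagonal ones, so the relation survives with the opposite middle coefficient.\<close>

lemma pencil_inverse: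
  assumes "M \<in> pencil l m v" "M ** N = mat 1"
  shows "N \<in> pencil l (- m) v"
proof -
  obtain d where "d \<noteq> 0" "N$1$1 = d * M$2$2" "N$1$2 = - d * M$1$2"
    "N$2$1 = - d * M$2$1" "N$2$2 = d * M$1$1"
    using right_inverse_2[OF assms(2)] .
  then show ?thesis
    using assms(1) unfolding pencil_def by simp algebra
qed

text \<open>Three rows annihilated by one nonzero vector have vanishing 3x3 determinant; its
  positive and negative terms are separated here.\<close>

lemma pencil_det_zero:
  fixes l m v :: "'a::field"
  assumes "(l, m, v) \<noteq> (0, 0, 0)"
    and "l * a1 + m * b1 + v * c1 = 0" "l * a2 + m * b2 + v * c2 = 0" "l * a3 + m * b3 + v * c3 = 0"
  shows "a1 * b2 * c3 + a2 * b3 * c1 + a3 * b1 * c2 = a1 * b3 * c2 + a2 * b1 * c3 + a3 * b2 * c1"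
    (is "?L = ?R")
proof -
  \<comment> \<open>Cramer's rule: the determinant times each component of the vector
    vanishes.\<close>
  have "l * (?L - ?R) = 0" "m * (?L - ?R) = 0" "v * (?L - ?R) = 0"
    using assms(2-) by algebra+
  then show ?thesis using assms(1) by auto
qed

text \<open>The difference \<open>B ** I ** C - C ** I ** B\<close> is alternating in
  \<open>A\<close>, \<open>B\<close>, \<open>C\<close>, hence a multiple of their 3x3 determinant,
  which is zero in the plane. The sum of the two products is a linear combination of
  \<open>A\<close>, \<open>B\<close>, \<open>C\<close> by polarised Cayley-Hamilton.\<close>

lemma pencil_triple:
  assumes nz: "(l, m, v) \<noteq> (0, 0, 0)" and inv: "A ** I = mat 1"
    and A: "A \<in> pencil l m v" and B: "B \<in> pencil l m v" and C: "C \<in> pencil l m v"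
  shows "B ** I ** C \<in> pencil l m v"
proof -
  obtain d where d: "d \<noteq> 0" "I$1$1 = d * A$2$2" "I$1$2 = - d * A$1$2"
    "I$2$1 = - d * A$2$1" "I$2$2 = d * A$1$1"
    using right_inverse_2[OF inv] .
  note mem = A B C
  have eqd: "A$1$1 = A$2$2" "B$1$1 = B$2$2" "C$1$1 = C$2$2"
    and rel: "l * A$1$2 + m * A$2$2 + v * A$2$1 = 0" "l * B$1$2 + m * B$2$2 + v * B$2$1 = 0"
      "l * C$1$2 + m * C$2$2 + v * C$2$1 = 0"
    using mem by (auto simp: pencil_def)
  let ?M = "B ** I ** C"
  note D = pencil_det_zero[OF nz rel]
  have "?M$1$1 = ?M$2$2"
    unfolding matrix_mul_2 d eqd using D by algebra
  moreover have "l * ?M$1$2 + m * ?M$1$1 + v * ?M$2$1 = 0"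
    unfolding matrix_mul_2 d eqd using D rel by algebra
  ultimately show ?thesis by (simp add: pencil_def)
qed

section \<open>Consistency of a cube as matrix equations\<close>

definition cube_eqs :: "'a::field^2^2 \<Rightarrow> 'a^2^2 \<Rightarrow> 'a^2^2 \<Rightarrow> 'a^2^2 \<Rightarrow> 'a^2^2 \<Rightarrow> 'a^2^2 \<Rightarrow> bool" where
  "cube_eqs A B C A' B' C' \<longleftrightarrow>
     A' ** B = B' ** A \<and> B' ** C = C' ** B \<and> C' ** A = A' ** C \<and>
     A' ** B + B' ** C + C' ** A = - mat 1"

lemma cube_eqs_cyclic: "cube_eqs A B C A' B' C' \<Longrightarrow> cube_eqs B C A B' C' A'"
  unfolding cube_eqs_def by (metis add.assoc add.commute)

lemma cube_eqs_pencil_step: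
  assumes nz: "(l, m, v) \<noteq> (0, 0, 0)" and "invertible A" and eqs: "cube_eqs A B C A' B' C'"
    and A: "A \<in> pencil l m v" and B: "B \<in> pencil l m v" and C: "C \<in> pencil l m v"
  shows "A' \<in> pencil l (- m) v"
proof -
  obtain I where I: "A ** I = mat 1"
    using \<open>invertible A\<close> by (auto simp: invertible_def)
  \<comment> \<open>This is the inverse of \<open>- A'\<close>: the first equation gives
    \<open>A' ** B ** I = B'\<close> and the third \<open>A' ** C = C' ** A\<close>, so
    \<open>A' ** X\<close> becomes the left side of the last equation.\<close>
  define X where "X = B + (B ** I ** C + C)"
  have X: "X \<in> pencil l m v"
    unfolding X_def by (intro pencil_add pencil_triple[OF nz I] A B C)
  have "A' ** (B ** I) = B'"
    using eqs I unfolding cube_eqs_def by (metis matrix_mul_assoc matrix_mul_rid)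
  then have "A' ** X = A' ** B + B' ** C + A' ** C"
    unfolding X_def by (simp add: matrix_add_ldistrib matrix_mul_assoc add.assoc)
  then have "A' ** X = - mat 1"
    using eqs unfolding cube_eqs_def by metis
  then have "X ** (- A') = mat 1"
    by (metis matrix_left_right_inverse matrix_mul_lneg minus_minus)
  from pencil_uminus[OF pencil_inverse[OF X this]] show ?thesis by simp
qed

lemma cube_eqs_pencil:
  assumes "(l, m, v) \<noteq> (0, 0, 0)" "invertible A" "invertible B" "invertible C"
    and "cube_eqs A B C A' B' C'"
    and "A \<in> pencil l m v" "B \<in> pencil l m v" "C \<in> pencil l m v"
  shows "A' \<in> pencil l (- m) v" "B' \<in> pencil l (- m) v" "C' \<in> pencil l (- m) v"
  using assms by (meson cube_eqs_pencil_step cube_eqs_cyclic)+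

text \<open>Both \<open>A' ** (B ** I ** C)\<close> and \<open>A' ** (C ** I ** B)\<close> equal
  \<open>B' ** C\<close>. Cancelling \<open>A'\<close> leaves an identity among the base matrices
  alone, which expresses their linear dependence.\<close>

lemma cube_eqs_relation:
  fixes A B C :: "complex^2^2"
  assumes eqs: "cube_eqs A B C A' B' C'" and "invertible A" "invertible A'"
    and diag: "A$1$1 = A$2$2" "B$1$1 = B$2$2" "C$1$1 = C$2$2"
  obtains l m v where "(l, m, v) \<noteq> (0, 0, 0)"
    "A \<in> pencil l m v" "B \<in> pencil l m v" "C \<in> pencil l m v"
proof -
  obtain I where I: "A ** I = mat 1"
    using \<open>invertible A\<close> by (auto simp: invertible_def)
  obtain d where d: "d \<noteq> 0" "I$1$1 = d * A$2$2" "I$1$2 = - d * A$1$2"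
    "I$2$1 = - d * A$2$1" "I$2$2 = d * A$1$1"
    using right_inverse_2[OF I] .
  have "A' ** (B ** I) = B'" "A' ** (C ** I) = C'"
    using eqs I unfolding cube_eqs_def by (metis matrix_mul_assoc matrix_mul_rid)+
  then have "A' ** (B ** I ** C) = A' ** (C ** I ** B)"
    using eqs unfolding cube_eqs_def by (metis matrix_mul_assoc)
  then have "B ** I ** C = C ** I ** B"
    by (rule invertible_cancel_left[OF \<open>invertible A'\<close>])
  \<comment> \<open>One entry suffices: the two (1,1) entries differ by \<open>d\<close> times the
    3x3 determinant of the coordinates, up to sign.\<close>
  then have "(B ** I ** C)$1$1 = (C ** I ** B)$1$1" by simp
  then have det: "A$1$2 * B$2$2 * C$2$1 + B$1$2 * C$2$2 * A$2$1 + C$1$2 * A$2$2 * B$2$1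
    = A$1$2 * C$2$2 * B$2$1 + B$1$2 * A$2$2 * C$2$1 + C$1$2 * B$2$2 * A$2$1"
    unfolding matrix_mul_2 d diag using \<open>d \<noteq> 0\<close> by algebra
  \<comment> \<open>The columns follow the order of the coefficients in \<open>pencil\<close>, so a
    kernel vector of \<open>T\<close> is the required triple.\<close>
  define T :: "complex^3^3" where
    "T = vector [vector [A$1$2, A$2$2, A$2$1], vector [B$1$2, B$2$2, B$2$1],
       vector [C$1$2, C$2$2, C$2$1]]"
  have "det T = 0"
    unfolding det_3 T_def vector_3 using det by algebra
  then have "\<not> invertible T" by (simp add: invertible_det_nz)
  then obtain x where x: "T *v x = 0" "x \<noteq> 0"
    unfolding invertible_left_inverse matrix_left_invertible_ker by blast
  then have "(x$1, x$2, x$3) \<noteq> (0, 0, 0)"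
    by (auto simp: vec_eq_iff forall_3)
  moreover have "M \<in> pencil (x$1) (x$2) (x$3)" if "M \<in> {A, B, C}" for M
    using that x(1) diag
    by (auto simp: T_def vec_eq_iff forall_3 matrix_vector_mult_def sum_3 pencil_def ac_simps)
  ultimately show ?thesis using that by blast
qed

text \<open>Re-reading the cube from the corner \<open>n + e i\<close>: reversing direction \<open>i\<close> replaces the matrices of
  the plaquettes containing that direction by their inverses and exchanges \<open>B\<close> with \<open>B'\<close>.\<close>

lemma cube_eqs_reflect:
  assumes eqs: "cube_eqs A B C A' B' C'"
    and A: "A ** IA = mat 1" and C: "C ** IC = mat 1" and A': "A' ** IA' = mat 1" and C': "C' ** IC' = mat 1"
  shows "cube_eqs IA B' IC IA' B IC'"
proof -
  have A'l: "IA' ** A' = mat 1" and C'l: "IC' ** C' = mat 1"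
    using A' C' by (simp_all add: matrix_left_right_inverse)
  have 1: "IA' ** B' = B ** IA"
  proof -
    have "A' ** (B ** IA) = B'"
      using eqs A unfolding cube_eqs_def by (metis matrix_mul_assoc matrix_mul_rid)
    then show ?thesis by (metis A'l matrix_mul_assoc matrix_mul_lid)
  qed
  have 2: "IC' ** B' = B ** IC"
  proof -
    have "C' ** (B ** IC) = B'"
      using eqs C unfolding cube_eqs_def by (metis matrix_mul_assoc matrix_mul_rid)
    then show ?thesis by (metis C'l matrix_mul_assoc matrix_mul_lid)
  qed
  have 3: "B ** IA + B ** IC + IC' ** IA = - mat 1"
  proof -
    have "IC' ** (B' ** A + B' ** C + C' ** A) ** IA = IC' ** (- mat 1) ** IA"
      using eqs unfolding cube_eqs_def by metis
    then have "IC' ** B' ** (A ** IA) + (IC' ** B') ** C ** IA + (IC' ** C') ** (A ** IA) = - (IC' ** IA)"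
      by (simp add: matrix_add_ldistrib matrix_add_rdistrib matrix_mul_assoc matrix_mul_lneg matrix_mul_rneg)
    moreover have "B ** IC ** C = B"
      using C by (metis matrix_left_right_inverse matrix_mul_assoc matrix_mul_rid)
    ultimately show ?thesis
      by (simp add: A C'l 2 algebra_simps eq_neg_iff_add_eq_0)
  qed
  \<comment> \<open>The same computation with \<open>A' ** C\<close> in place of
    \<open>C' ** A\<close>; comparison with the previous sum yields the missing commutation
    relation.\<close>
  have 4: "B ** IA + B ** IC + IA' ** IC = - mat 1"
  proof -
    have "IA' ** (B' ** A + B' ** C + A' ** C) ** IC = IA' ** (- mat 1) ** IC"
      using eqs unfolding cube_eqs_def by metis
    then have "(IA' ** B') ** A ** IC + (IA' ** B') ** (C ** IC) + (IA' ** A') ** (C ** IC) = - (IA' ** IC)"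
      by (simp add: matrix_add_ldistrib matrix_add_rdistrib matrix_mul_assoc matrix_mul_lneg matrix_mul_rneg)
    moreover have "B ** IA ** A = B"
      using A by (metis matrix_left_right_inverse matrix_mul_assoc matrix_mul_rid)
    ultimately show ?thesis
      by (simp add: C A'l 1 algebra_simps eq_neg_iff_add_eq_0)
  qed
  have "IC' ** IA = IA' ** IC"
    using 3 4 by (metis add_left_cancel)
  then show ?thesis
    using 1 2 3 unfolding cube_eqs_def by simp
qed

section \<open>Scalar equations equivalent to the matrix equations\<close>

text \<open>For nonzero \<xi>, \<eta>, \<open>M\<close> sends the row (1, -\<xi>) to a multiple of
  (1/\<eta>, 1), parallel to (1, \<eta>), and \<open>N\<close> sends (1, \<eta>) to a multiple of
  (-1/\<xi>, 1); \<open>s\<close> is the product of the two factors. Both components of the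
  resulting row are stated with denominators cleared.\<close>

lemma pencil_product:
  assumes M: "M \<in> pencil l (- (l * (\<xi> + \<eta>))) (l * \<xi> * \<eta>)"
    and N: "N \<in> pencil l (l * (\<xi> + \<eta>)) (l * \<xi> * \<eta>)" and "l \<noteq> 0"
  defines "s \<equiv> (M$1$2 - \<xi> * M$1$1) * (N$1$2 + \<eta> * N$1$1)"
  shows "\<eta> * ((M ** N)$1$2 - \<xi> * (M ** N)$2$2) = s"
    and "\<xi> * \<eta> * ((M ** N)$1$1 - \<xi> * (M ** N)$2$1) = - s"
proof -
  have "l * (M$1$2 - (\<xi> + \<eta>) * M$2$2 + \<xi> * \<eta> * M$2$1) = 0"
    "l * (N$1$2 + (\<xi> + \<eta>) * N$2$2 + \<xi> * \<eta> * N$2$1) = 0"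
    using M N unfolding pencil_def by (auto simp: algebra_simps)
  then have rel: "M$1$2 - (\<xi> + \<eta>) * M$2$2 + \<xi> * \<eta> * M$2$1 = 0"
    "N$1$2 + (\<xi> + \<eta>) * N$2$2 + \<xi> * \<eta> * N$2$1 = 0"
    using \<open>l \<noteq> 0\<close> by simp_all
  have diag: "M$1$1 = M$2$2" "N$1$1 = N$2$2"
    using M N by (simp_all add: pencil_def)
  show "\<eta> * ((M ** N)$1$2 - \<xi> * (M ** N)$2$2) = s"
    unfolding s_def matrix_mul_2 diag using rel by algebra
  show "\<xi> * \<eta> * ((M ** N)$1$1 - \<xi> * (M ** N)$2$1) = - s"
    unfolding s_def matrix_mul_2 diag using rel by algebra
qed

text \<open>Modulo the relation, the product of the two factors is \<xi>\<eta> times the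
  determinant.\<close>

lemma pencil_invertible_factors:
  fixes M :: "'a::field^2^2"
  assumes M: "M \<in> pencil l (l * (\<xi> + \<eta>)) (l * \<xi> * \<eta>)" and "l \<noteq> 0" "\<xi> \<noteq> 0" "\<eta> \<noteq> 0" "invertible M"
  shows "M$1$2 + \<xi> * M$1$1 \<noteq> 0" "M$1$2 + \<eta> * M$1$1 \<noteq> 0"
proof -
  have "l * (M$1$2 + (\<xi> + \<eta>) * M$2$2 + \<xi> * \<eta> * M$2$1) = 0" and diag: "M$1$1 = M$2$2"
    using M unfolding pencil_def by (auto simp: algebra_simps)
  then have "M$1$2 + (\<xi> + \<eta>) * M$2$2 + \<xi> * \<eta> * M$2$1 = 0"
    using \<open>l \<noteq> 0\<close> by simp
  then have "(M$1$2 + \<xi> * M$1$1) * (M$1$2 + \<eta> * M$1$1) =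
      \<xi> * \<eta> * (M$1$1 * M$2$2 - M$1$2 * M$2$1)"
    unfolding diag by algebra
  then show "M$1$2 + \<xi> * M$1$1 \<noteq> 0" "M$1$2 + \<eta> * M$1$1 \<noteq> 0"
    using assms(3-) by (auto simp: invertible_2_iff)
qed

text \<open>The scalar shadow of \<open>cube_eqs\<close>, free of division: \<open>p1\<close>,
  \<open>p2\<close>, \<open>p3\<close> belong to the opposite plaquettes, \<open>q1\<close>,
  \<open>q2\<close>, \<open>q3\<close> to the base.\<close>

definition star_products :: "'a::field \<Rightarrow> 'a \<Rightarrow> 'a \<Rightarrow> 'a \<Rightarrow> 'a \<Rightarrow> 'a \<Rightarrow> 'a \<Rightarrow> bool" where
  "star_products r p1 p2 p3 q1 q2 q3 \<longleftrightarrow>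
     p1 * q2 = p2 * q1 \<and> p2 * q3 = p3 * q2 \<and> p3 * q1 = p1 * q3 \<and>
     p1 * q2 + p2 * q3 + p3 * q1 = r"

text \<open>With \<open>S\<close> the symmetric sum of products of the q's, both sides say that each
  p times \<open>S\<close> is \<open>r\<close> times the corresponding q. Cancelling
  \<open>S\<close> is legitimate because \<open>r * q1\<close> is nonzero.\<close>

lemma star_products_iff:
  fixes r :: "'a::field"
  assumes "r \<noteq> 0" and nz: "p1 \<noteq> 0" "p2 \<noteq> 0" "p3 \<noteq> 0" "q1 \<noteq> 0" "q2 \<noteq> 0" "q3 \<noteq> 0"
  shows "star_products r p1 p2 p3 q1 q2 q3 \<longleftrightarrow>
    1 / p1 = 1 / r * ((q1 * q2 + q2 * q3 + q3 * q1) / q1) \<and>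
    1 / p2 = 1 / r * ((q2 * q3 + q3 * q1 + q1 * q2) / q2) \<and>
    1 / p3 = 1 / r * ((q3 * q1 + q1 * q2 + q2 * q3) / q3)"
    (is "_ \<longleftrightarrow> ?star")
proof -
  define S where "S = q1 * q2 + q2 * q3 + q3 * q1"
  have "?star \<longleftrightarrow> p1 * S = r * q1 \<and> p2 * S = r * q2 \<and> p3 * S = r * q3"
    using assms unfolding S_def by (simp add: field_simps) (auto simp: algebra_simps)
  also have "\<dots> \<longleftrightarrow> star_products r p1 p2 p3 q1 q2 q3"
  proof
    assume star: "p1 * S = r * q1 \<and> p2 * S = r * q2 \<and> p3 * S = r * q3"
    with assms have "S \<noteq> 0" by auto
    have "S * (p1 * q2 - p2 * q1) = 0" "S * (p2 * q3 - p3 * q2) = 0" "S * (p3 * q1 - p1 * q3) = 0"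
      "S * (p1 * q2 + p2 * q3 + p3 * q1 - r) = 0"
      using star unfolding S_def by algebra+
    with \<open>S \<noteq> 0\<close> show "star_products r p1 p2 p3 q1 q2 q3"
      unfolding star_products_def by simp
  next
    assume "star_products r p1 p2 p3 q1 q2 q3"
    then show "p1 * S = r * q1 \<and> p2 * S = r * q2 \<and> p3 * S = r * q3"
      unfolding star_products_def S_def by algebra
  qed
  finally show ?thesis by simp
qed

text \<open>The functional \<phi> is linear and turns each matrix product into a product of scalars
  by \<open>pencil_product\<close>; it maps \<open>- mat 1\<close> to \<xi>\<eta>, the constant of
  the scalar system.\<close>

lemma cube_eqs_star_products:
  fixes A B C A' B' C' :: "'a::field^2^2"
  assumes base: "A \<in> pencil l (l * (\<xi> + \<eta>)) (l * \<xi> * \<eta>)" "B \<in> pencil l (l * (\<xi> + \<eta>)) (l * \<xi> * \<eta>)"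
      "C \<in> pencil l (l * (\<xi> + \<eta>)) (l * \<xi> * \<eta>)"
    and opp: "A' \<in> pencil l (- (l * (\<xi> + \<eta>))) (l * \<xi> * \<eta>)" "B' \<in> pencil l (- (l * (\<xi> + \<eta>))) (l * \<xi> * \<eta>)"
      "C' \<in> pencil l (- (l * (\<xi> + \<eta>))) (l * \<xi> * \<eta>)"
    and "l \<noteq> 0" and eqs: "cube_eqs A B C A' B' C'"
  shows "star_products (\<xi> * \<eta>) (A'$1$2 - \<xi> * A'$1$1) (B'$1$2 - \<xi> * B'$1$1) (C'$1$2 - \<xi> * C'$1$1)
    (A$1$2 + \<eta> * A$1$1) (B$1$2 + \<eta> * B$1$1) (C$1$2 + \<eta> * C$1$1)"
proof -
  define \<phi> where "\<phi> N = \<eta> * (N$1$2 - \<xi> * N$2$2)" for N :: "'a^2^2"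
  have \<phi>: "\<phi> (M ** N) = (M$1$2 - \<xi> * M$1$1) * (N$1$2 + \<eta> * N$1$1)"
    if "M \<in> {A', B', C'}" "N \<in> {A, B, C}" for M N
    unfolding \<phi>_def using that base opp \<open>l \<noteq> 0\<close> by (intro pencil_product(1)) auto
  have "\<phi> (A' ** B) + \<phi> (B' ** C) + \<phi> (C' ** A) = \<phi> (A' ** B + B' ** C + C' ** A)"
    by (simp add: \<phi>_def algebra_simps)
  also have "A' ** B + B' ** C + C' ** A = - mat 1"
    using eqs unfolding cube_eqs_def by blast
  also have "\<phi> (- mat 1) = \<xi> * \<eta>"
    by (simp add: \<phi>_def mat_def)
  finally have "\<phi> (A' ** B) + \<phi> (B' ** C) + \<phi> (C' ** A) = \<xi> * \<eta>" .
  moreover have "\<phi> (A' ** B) = \<phi> (B' ** A)" "\<phi> (B' ** C) = \<phi> (C' ** B)" "\<phi> (C' ** A) = \<phi> (A' ** C)"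
    using eqs unfolding cube_eqs_def by metis+
  ultimately show ?thesis
    unfolding star_products_def by (simp add: \<phi>)
qed

lemma matrix_2_eq_0I:
  fixes N :: "'a::field^2^2"
  assumes "\<xi> \<noteq> \<eta>" "N$1$2 - \<xi> * N$2$2 = 0" "N$1$1 - \<xi> * N$2$1 = 0"
    "N$1$2 - \<eta> * N$2$2 = 0" "N$1$1 - \<eta> * N$2$1 = 0"
  shows "N = 0"
proof -
  have "(\<xi> - \<eta>) * N$2$2 = 0" "(\<xi> - \<eta>) * N$2$1 = 0"
    using assms(2-) by algebra+
  with assms show ?thesis
    by (simp add: matrix_2_eq_iff)
qed

text \<open>The row vectors \<open>(1, - \<xi>)\<close> and \<open>(1, - \<eta>)\<close> form a basis if \<open>\<xi> \<noteq> \<eta>\<close>, so the two systems of scalar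
  products determine the matrix products.\<close>

lemma star_products_cube_eqs:
  fixes A B C A' B' C' :: "'a::field^2^2"
  assumes base: "A \<in> pencil l (l * (\<xi> + \<eta>)) (l * \<xi> * \<eta>)" "B \<in> pencil l (l * (\<xi> + \<eta>)) (l * \<xi> * \<eta>)"
      "C \<in> pencil l (l * (\<xi> + \<eta>)) (l * \<xi> * \<eta>)"
    and opp: "A' \<in> pencil l (- (l * (\<xi> + \<eta>))) (l * \<xi> * \<eta>)" "B' \<in> pencil l (- (l * (\<xi> + \<eta>))) (l * \<xi> * \<eta>)"
      "C' \<in> pencil l (- (l * (\<xi> + \<eta>))) (l * \<xi> * \<eta>)"
    and nz: "l \<noteq> 0" "\<xi> \<noteq> 0" "\<eta> \<noteq> 0" and "\<xi> \<noteq> \<eta>"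
    and "star_products (\<xi> * \<eta>) (A'$1$2 - \<xi> * A'$1$1) (B'$1$2 - \<xi> * B'$1$1) (C'$1$2 - \<xi> * C'$1$1)
      (A$1$2 + \<eta> * A$1$1) (B$1$2 + \<eta> * B$1$1) (C$1$2 + \<eta> * C$1$1)"
    and "star_products (\<xi> * \<eta>) (A'$1$2 - \<eta> * A'$1$1) (B'$1$2 - \<eta> * B'$1$1) (C'$1$2 - \<eta> * C'$1$1)
      (A$1$2 + \<xi> * A$1$1) (B$1$2 + \<xi> * B$1$1) (C$1$2 + \<xi> * C$1$1)"
  shows "cube_eqs A B C A' B' C'"
proof -
  \<comment> \<open>Each scalar computation is done for both orders of the roots at once; \<phi> and
    \<psi> are the scaled components of the row (1, -x) times \<open>N\<close>.\<close>
  define E where "E = {(\<xi>, \<eta>), (\<eta>, \<xi>)}"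
  define \<phi> where "\<phi> x y N = y * (N$1$2 - x * N$2$2)" for x y and N :: "'a^2^2"
  define \<psi> where "\<psi> x y N = x * y * (N$1$1 - x * N$2$1)" for x y and N :: "'a^2^2"
  have prod: "\<phi> x y (M ** N) = (M$1$2 - x * M$1$1) * (N$1$2 + y * N$1$1)"
    "\<psi> x y (M ** N) = - ((M$1$2 - x * M$1$1) * (N$1$2 + y * N$1$1))"
    if "(x, y) \<in> E" "M \<in> {A', B', C'}" "N \<in> {A, B, C}" for x y M N
  proof -
    have M: "M \<in> pencil l (- (l * (x + y))) (l * x * y)"
      using that opp by (auto simp: E_def ac_simps)
    have N: "N \<in> pencil l (l * (x + y)) (l * x * y)"
      using that base by (auto simp: E_def ac_simps)
    show "\<phi> x y (M ** N) = (M$1$2 - x * M$1$1) * (N$1$2 + y * N$1$1)"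
      "\<psi> x y (M ** N) = - ((M$1$2 - x * M$1$1) * (N$1$2 + y * N$1$1))"
      unfolding \<phi>_def \<psi>_def by (fact pencil_product[OF M N \<open>l \<noteq> 0\<close>])+
  qed
  have star: "star_products (x * y) (A'$1$2 - x * A'$1$1) (B'$1$2 - x * B'$1$1) (C'$1$2 - x * C'$1$1)
      (A$1$2 + y * A$1$1) (B$1$2 + y * B$1$1) (C$1$2 + y * C$1$1)" if "(x, y) \<in> E" for x y
    using that assms(11,12) by (auto simp: E_def mult.commute)
  have lin: "\<phi> x y (M - N) = \<phi> x y M - \<phi> x y N" "\<psi> x y (M - N) = \<psi> x y M - \<psi> x y N"
    "\<phi> x y (M + N) = \<phi> x y M + \<phi> x y N" "\<psi> x y (M + N) = \<psi> x y M + \<psi> x y N"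
    "\<phi> x y (- mat 1) = x * y" "\<psi> x y (- mat 1) = - (x * y)" for x y M N
    by (simp_all add: \<phi>_def \<psi>_def algebra_simps mat_def)
  have eqI: "M = N" if "\<And>x y. (x, y) \<in> E \<Longrightarrow> \<phi> x y M = \<phi> x y N \<and> \<psi> x y M = \<psi> x y N" for M N
  proof -
    have "\<phi> \<xi> \<eta> (M - N) = 0" "\<psi> \<xi> \<eta> (M - N) = 0" "\<phi> \<eta> \<xi> (M - N) = 0" "\<psi> \<eta> \<xi> (M - N) = 0"
      using that by (simp_all add: lin E_def)
    then have "M - N = 0"
      using nz unfolding \<phi>_def \<psi>_def by (intro matrix_2_eq_0I[OF \<open>\<xi> \<noteq> \<eta>\<close>]) simp_all
    then show ?thesis by simp
  qed
  show ?thesis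
    unfolding cube_eqs_def
  proof (intro conjI eqI)
    fix x y assume xy: "(x, y) \<in> E"
    note [simp] = lin prod[OF xy]
    note star[OF xy, unfolded star_products_def]
    then show "\<phi> x y (A' ** B) = \<phi> x y (B' ** A)" "\<psi> x y (A' ** B) = \<psi> x y (B' ** A)"
      "\<phi> x y (B' ** C) = \<phi> x y (C' ** B)" "\<psi> x y (B' ** C) = \<psi> x y (C' ** B)"
      "\<phi> x y (C' ** A) = \<phi> x y (A' ** C)" "\<psi> x y (C' ** A) = \<psi> x y (A' ** C)"
      and sum: "\<phi> x y (A' ** B + B' ** C + C' ** A) = \<phi> x y (- mat 1)"
      by auto
    \<comment> \<open>On the products and on \<open>- mat 1\<close>, \<psi> is the negative of
      \<phi>, so the second component of the sum follows from the first.\<close>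
    have "\<psi> x y (A' ** B + B' ** C + C' ** A) = - \<phi> x y (A' ** B + B' ** C + C' ** A)" by simp
    also have "\<dots> = \<psi> x y (- mat 1)"
      unfolding sum by simp
    finally show "\<psi> x y (A' ** B + B' ** C + C' ** A) = \<psi> x y (- mat 1)" .
  qed
qed

section \<open>Roots of the quadratic equation\<close>

text \<open>Vieta's formulas. The point is multiplicity: a set of roots does not record it, but a
  set with two distinct elements rules out a double root.\<close>

lemma minus_roots_iff:
  assumes "l \<noteq> 0"
  shows "minus_roots l m v \<xi> \<eta> \<longleftrightarrow> m = l * (\<xi> + \<eta>) \<and> v = l * \<xi> * \<eta>"
proof
  assume "m = l * (\<xi> + \<eta>) \<and> v = l * \<xi> * \<eta>"
  then have "l * x\<^sup>2 + m * x + v = l * ((x + \<xi>) * (x + \<eta>))" for x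
    by (simp add: algebra_simps power2_eq_square)
  then show "minus_roots l m v \<xi> \<eta>"
    unfolding minus_roots_def using \<open>l \<noteq> 0\<close> by (auto simp: add_eq_0_iff2)
next
  assume "minus_roots l m v \<xi> \<eta>"
  then have iff: "l * x\<^sup>2 + m * x + v = 0 \<longleftrightarrow> x = - \<xi> \<or> x = - \<eta>" for x
    unfolding minus_roots_def by (auto simp: set_eq_iff)
  \<comment> \<open>The sum of the roots forces the second root to be \<open>- r\<close>. If
    \<open>r\<close> happens to be \<xi>, the polynomial is a square and \<eta> must coincide with
    \<xi> too.\<close>
  define r where "r = m / l - \<xi>"
  have m: "m = l * (\<xi> + r)"
    using \<open>l \<noteq> 0\<close> by (simp add: r_def)
  have "l * (- \<xi>)\<^sup>2 + m * (- \<xi>) + v = 0" using iff by blast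
  then have v: "v = l * \<xi> * r"
    unfolding m by algebra
  have "l * (- r)\<^sup>2 + m * (- r) + v = 0"
    unfolding m v by algebra
  then have "r = \<xi> \<or> r = \<eta>" unfolding iff by simp
  moreover have "\<eta> = \<xi>" if "r = \<xi>"
  proof -
    have "l * (- \<eta>)\<^sup>2 + m * (- \<eta>) + v = 0" using iff by blast
    then have "l * (\<eta> - \<xi>)\<^sup>2 = 0" unfolding m v that by algebra
    then show ?thesis using \<open>l \<noteq> 0\<close> by simp
  qed
  ultimately have "r = \<eta>" by auto
  with m v show "m = l * (\<xi> + \<eta>) \<and> v = l * \<xi> * \<eta>" by simp
qed

lemma minus_roots_exist:
  assumes "l \<noteq> 0"
  obtains \<xi> \<eta> where "minus_roots l m v \<xi> \<eta>"
proof -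
  define s where "s = csqrt (m\<^sup>2 - 4 * l * v)"
  have s: "s * s = m\<^sup>2 - 4 * l * v" by (simp add: s_def flip: power2_eq_square)
  have "l * ((m + s) / (2 * l)) * ((m - s) / (2 * l)) = (m + s) * (m - s) / (4 * l)"
    using assms by (simp add: field_simps)
  also have "(m + s) * (m - s) = 4 * l * v"
    using s by (simp add: algebra_simps power2_eq_square)
  finally have "minus_roots l m v ((m + s) / (2 * l)) ((m - s) / (2 * l))"
    unfolding minus_roots_iff[OF assms] using assms by (simp add: field_simps)
  then show ?thesis by (rule that)
qed

section \<open>From fields on the lattice to matrix equations\<close>

lemma e_nth [simp]: "e k $ l = (if l = k then 1 else 0)"
  by (simp add: e_def axis_def)

lemma parity_sign_cases: "parity_sign n = 1 \<or> parity_sign n = - 1"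
  unfolding parity_sign_def by (simp add: power_int_minus_left)

lemma parity_sign_add_e: "parity_sign (n + e k) = - parity_sign n"
  by (simp add: parity_sign_def sum.distrib power_int_add)

text \<open>The parity sign goes into the middle coefficient, so that a unit shift of the base point
  acts on pencils as matrix inversion does.\<close>

lemma lin_rel_iff_pencil:
  "lin_rel a b c l m v n i j \<longleftrightarrow> coeff_matrix a b c n i j \<in> pencil l (m * parity_sign n) v"
  by (simp add: lin_rel_def pencil_def coeff_matrix_def)

lemma moutard_iff:
  fixes a b c n i j w
  defines "M \<equiv> coeff_matrix a b c n i j"
  shows "moutard a b c (\<lambda>x. w x $ 1) (\<lambda>x. w x $ 2) n i j \<longleftrightarrow>
    w (n + e i + e j) - w n = M *v (w (n + e i) - w (n + e j))"
proof -
  have vec: "vector [x$1, x$2] = x" for x :: "complex^2"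
    by (simp add: vec_eq_iff forall_2)
  show ?thesis
    unfolding moutard_def M_def by (simp flip: vector_minus_component add: vec)
qed

text \<open>Joining \<open>u\<close> and \<open>v\<close> into one vector field makes every face a
  single matrix-vector equation.\<close>

lemma cube_consistent_iff_fields:
  "cube_consistent a b c n i j k \<longleftrightarrow>
    (\<forall>w0 wi wj wk :: complex^2. \<exists>w. w n = w0 \<and> w (n + e i) = wi \<and> w (n + e j) = wj \<and> w (n + e k) = wk \<and>
       (\<forall>(n', i', j') \<in> {(n, i, j), (n + e k, i, j), (n, j, k), (n + e i, j, k), (n, k, i), (n + e j, k, i)}.
          w (n' + e i' + e j') - w n' = coeff_matrix a b c n' i' j' *v (w (n' + e i') - w (n' + e j'))))"
  (is "_ \<longleftrightarrow> ?fields")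
proof
  assume cons: "cube_consistent a b c n i j k"
  show ?fields
  proof (intro allI)
    fix w0 wi wj wk :: "complex^2"
    obtain u v where uv: "u n = w0$1 \<and> v n = w0$2 \<and> u (n + e i) = wi$1 \<and> v (n + e i) = wi$2 \<and>
        u (n + e j) = wj$1 \<and> v (n + e j) = wj$2 \<and> u (n + e k) = wk$1 \<and> v (n + e k) = wk$2 \<and>
        moutard a b c u v n i j \<and> moutard a b c u v (n + e k) i j \<and>
        moutard a b c u v n j k \<and> moutard a b c u v (n + e i) j k \<and>
        moutard a b c u v n k i \<and> moutard a b c u v (n + e j) k i"
      using cons unfolding cube_consistent_def by blast
    define w :: "int^'a \<Rightarrow> complex^2" where "w x = vector [u x, v x]" for x
    have "u = (\<lambda>x. w x $ 1)" "v = (\<lambda>x. w x $ 2)" by (simp_all add: w_def)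
    with uv show "\<exists>w. w n = w0 \<and> w (n + e i) = wi \<and> w (n + e j) = wj \<and> w (n + e k) = wk \<and>
       (\<forall>(n', i', j') \<in> {(n, i, j), (n + e k, i, j), (n, j, k), (n + e i, j, k), (n, k, i), (n + e j, k, i)}.
          w (n' + e i' + e j') - w n' = coeff_matrix a b c n' i' j' *v (w (n' + e i') - w (n' + e j')))"
      by (intro exI[of _ w]) (simp add: moutard_iff vec_eq_iff[of "w _" "_ :: complex^2"] forall_2)
  qed
next
  assume fields: ?fields
  show "cube_consistent a b c n i j k"
    unfolding cube_consistent_def
  proof (intro allI)
    fix u0 v0 ui vi uj vj uk vk
    obtain w :: "int^'a \<Rightarrow> complex^2" where w: "w n = vector [u0, v0]" "w (n + e i) = vector [ui, vi]"
      "w (n + e j) = vector [uj, vj]" "w (n + e k) = vector [uk, vk]"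
      and eqs: "\<forall>(n', i', j') \<in> {(n, i, j), (n + e k, i, j), (n, j, k), (n + e i, j, k), (n, k, i), (n + e j, k, i)}.
          w (n' + e i' + e j') - w n' = coeff_matrix a b c n' i' j' *v (w (n' + e i') - w (n' + e j'))"
      using fields by meson
    show "\<exists>u v. u n = u0 \<and> v n = v0 \<and> u (n + e i) = ui \<and> v (n + e i) = vi \<and>
        u (n + e j) = uj \<and> v (n + e j) = vj \<and> u (n + e k) = uk \<and> v (n + e k) = vk \<and>
        moutard a b c u v n i j \<and> moutard a b c u v (n + e k) i j \<and>
        moutard a b c u v n j k \<and> moutard a b c u v (n + e i) j k \<and>
        moutard a b c u v n k i \<and> moutard a b c u v (n + e j) k i"
      by (rule exI[of _ "\<lambda>x. w x $ 1"], rule exI[of _ "\<lambda>x. w x $ 2"])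
        (use eqs in \<open>simp add: moutard_iff w\<close>)
  qed
qed

lemma matrix_vector_mult_lneg: "(- M) *v x = - (M *v x)" for M :: "'a::ring_1^'n^'m"
  by (simp add: matrix_vector_mult_def vec_eq_iff sum_negf)

text \<open>With value 0 at the base and \<open>x\<close>, \<open>y\<close>, \<open>z\<close> at its
  neighbours, the three expressions compute the value at the far vertex through three faces. Their
  agreement is compared coefficient by coefficient.\<close>

lemma cube_eqs_iff:
  fixes A B C A' B' C' :: "complex^2^2"
  shows "cube_eqs A B C A' B' C' \<longleftrightarrow>
    (\<forall>x y z. z + A' *v (C *v (z - x) - B *v (y - z)) = x + B' *v (A *v (x - y) - C *v (z - x)) \<and>
       z + A' *v (C *v (z - x) - B *v (y - z)) = y + C' *v (B *v (y - z) - A *v (x - y)))"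
    (is "_ \<longleftrightarrow> (\<forall>x y z. ?P x y z = ?Q x y z \<and> ?P x y z = ?R x y z)")
proof
  assume "cube_eqs A B C A' B' C'"
  then have comm: "A' ** B = B' ** A" "B' ** C = C' ** B" "C' ** A = A' ** C"
    and sum: "A' ** B + B' ** C + C' ** A = - mat 1"
    unfolding cube_eqs_def by blast+
  have id: "(A' ** B) *v x + (B' ** C) *v x + (C' ** A) *v x = - x" for x
    using arg_cong[OF sum, of "\<lambda>M. M *v x"]
    by (simp add: matrix_vector_mult_add_rdistrib matrix_vector_mult_lneg)
  show "\<forall>x y z. ?P x y z = ?Q x y z \<and> ?P x y z = ?R x y z"
  proof (intro allI)
    fix x y z
    \<comment> \<open>The common far value, in a form invariant under cyclic permutation.\<close>
    let ?t = "- ((C' ** A) *v x) - (A' ** B) *v y - (B' ** C) *v z"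
    have "?P x y z = ?t"
      using id[of z] comm
      by (simp add: matrix_vector_mult_diff_distrib matrix_vector_mul_assoc) (simp add: algebra_simps eq_neg_iff_add_eq_0)
    moreover have "?Q x y z = ?t"
      using id[of x] comm
      by (simp add: matrix_vector_mult_diff_distrib matrix_vector_mul_assoc) (simp add: algebra_simps eq_neg_iff_add_eq_0)
    moreover have "?R x y z = ?t"
      using id[of y] comm
      by (simp add: matrix_vector_mult_diff_distrib matrix_vector_mul_assoc) (simp add: algebra_simps eq_neg_iff_add_eq_0)
    ultimately show "?P x y z = ?Q x y z \<and> ?P x y z = ?R x y z" by simp
  qed
next
  assume "\<forall>x y z. ?P x y z = ?Q x y z \<and> ?P x y z = ?R x y z"
  then have PQ: "?P x y z = ?Q x y z" and PR: "?P x y z = ?R x y z" for x y z by blast+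
  have neg: "M *v (- x) = - (M *v x)" for M :: "complex^2^2" and x
    using matrix_vector_mult_diff_distrib[of M 0 x] by simp
  note simps = matrix_vector_mul_assoc neg matrix_vector_mult_diff_distrib matrix_vector_mult_add_rdistrib
  have "(A' ** B) *v y = (B' ** A) *v y" for y
    using PQ[where x=0 and y=y and z=0] by (simp add: simps)
  moreover have "(B' ** C) *v z = (C' ** B) *v z" for z
    using PQ[where x=0 and y=0 and z=z] PR[where x=0 and y=0 and z=z] by (simp add: simps)
  moreover have "(C' ** A) *v x = (A' ** C) *v x" for x
    using PR[where x=x and y=0 and z=0] by (simp add: simps)
  moreover have "(A' ** B + B' ** C + C' ** A) *v x = (- mat 1) *v x" for x
    using PQ[where x=x and y=0 and z=0] PR[where x=x and y=0 and z=0] calculation(1)[of x]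
    by (simp add: simps matrix_vector_mult_lneg) (simp add: algebra_simps eq_neg_iff_add_eq_0 matrix_vector_mul_assoc)
  ultimately show "cube_eqs A B C A' B' C'"
    unfolding cube_eqs_def by (simp add: matrix_eq)
qed

text \<open>The three base faces determine the fields at the doubly shifted vertices, so the only
  obstruction is agreement of the three values at the far vertex.\<close>

lemma cube_consistent_iff:
  assumes "distinct [i, j, k]"
  shows "cube_consistent a b c n i j k \<longleftrightarrow>
    cube_eqs (coeff_matrix a b c n i j) (coeff_matrix a b c n j k) (coeff_matrix a b c n k i)
      (coeff_matrix a b c (n + e k) i j) (coeff_matrix a b c (n + e i) j k) (coeff_matrix a b c (n + e j) k i)"
    (is "_ \<longleftrightarrow> cube_eqs ?A ?B ?C ?A' ?B' ?C'")
proof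
  assume cons: "cube_consistent a b c n i j k"
  show "cube_eqs ?A ?B ?C ?A' ?B' ?C'"
    unfolding cube_eqs_iff
  proof (intro allI)
    fix x y z :: "complex^2"
    obtain w where w: "w n = 0" "w (n + e i) = x" "w (n + e j) = y" "w (n + e k) = z"
      and eqs: "\<forall>(n', i', j') \<in> {(n, i, j), (n + e k, i, j), (n, j, k), (n + e i, j, k), (n, k, i), (n + e j, k, i)}.
          w (n' + e i' + e j') - w n' = coeff_matrix a b c n' i' j' *v (w (n' + e i') - w (n' + e j'))"
      using cons unfolding cube_consistent_iff_fields by meson
    have ac: "n + e j + e i = n + e i + e j" "n + e k + e j = n + e j + e k" "n + e i + e k = n + e k + e i"
      "n + e k + e i + e j = n + e i + e j + e k"
      "n + e j + e k + e i = n + e i + e j + e k"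
      by (simp_all add: ac_simps)
    have w2: "w (n + e i + e j) = ?A *v (x - y)" "w (n + e j + e k) = ?B *v (y - z)"
      "w (n + e k + e i) = ?C *v (z - x)"
      using eqs by (simp_all add: w)
    have w3: "w (n + e i + e j + e k) = ?A' *v (?C *v (z - x) - ?B *v (y - z)) + z"
      "w (n + e i + e j + e k) = ?B' *v (?A *v (x - y) - ?C *v (z - x)) + x"
      "w (n + e i + e j + e k) = ?C' *v (?B *v (y - z) - ?A *v (x - y)) + y"
      using eqs by (simp_all add: w ac w2 diff_eq_eq) metis+
    show "z + ?A' *v (?C *v (z - x) - ?B *v (y - z)) = x + ?B' *v (?A *v (x - y) - ?C *v (z - x)) \<and>
       z + ?A' *v (?C *v (z - x) - ?B *v (y - z)) = y + ?C' *v (?B *v (y - z) - ?A *v (x - y))"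
      unfolding add.commute[of z] add.commute[of x] add.commute[of y] using w3 by argo
  qed
next
  assume eqs: "cube_eqs ?A ?B ?C ?A' ?B' ?C'"
  show "cube_consistent a b c n i j k"
    unfolding cube_consistent_iff_fields
  proof (intro allI)
    fix w0 wi wj wk :: "complex^2"
    define wij where "wij = w0 + ?A *v (wi - wj)"
    define wjk where "wjk = w0 + ?B *v (wj - wk)"
    define wki where "wki = w0 + ?C *v (wk - wi)"
    define wijk where "wijk = wk + ?A' *v (wki - wjk)"
    have E: "wijk = wi + ?B' *v (wij - wki)" "wijk = wj + ?C' *v (wjk - wij)"
      using spec[OF spec[OF spec[OF eqs[unfolded cube_eqs_iff], of wi], of wj], of wk]
      unfolding wijk_def wki_def wjk_def wij_def add_diff_cancel_left by argo+
    have faces: "wij - w0 = ?A *v (wi - wj)" "wjk - w0 = ?B *v (wj - wk)" "wki - w0 = ?C *v (wk - wi)"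
      "wijk - wk = ?A' *v (wki - wjk)" "wijk - wi = ?B' *v (wij - wki)" "wijk - wj = ?C' *v (wjk - wij)"
      by (simp add: wij_def, simp add: wjk_def, simp add: wki_def, simp add: wijk_def, simp add: E(1), simp add: E(2))
    \<comment> \<open>The cube values are extended to the whole lattice by reading every nonzero
      relative coordinate as 1 and ignoring the other directions.\<close>
    define W where "W p q r =
        (if p = 0 then if q = 0 then if r = 0 then w0 else wk else if r = 0 then wj else wjk
         else if q = 0 then if r = 0 then wi else wki else if r = 0 then wij else wijk)" for p q r :: int
    define w where "w x = W (x$i - n$i) (x$j - n$j) (x$k - n$k)" for x
    have d: "i \<noteq> j" "j \<noteq> i" "j \<noteq> k" "k \<noteq> j" "k \<noteq> i" "i \<noteq> k" using assms by auto
    have w: "w n = w0" "w (n + e i) = wi" "w (n + e j) = wj" "w (n + e k) = wk"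
      "w (n + e i + e j) = wij" "w (n + e j + e k) = wjk" "w (n + e k + e i) = wki"
      "w (n + e j + e i) = wij" "w (n + e k + e j) = wjk" "w (n + e i + e k) = wki"
      "w (n + e k + e i + e j) = wijk" "w (n + e i + e j + e k) = wijk" "w (n + e j + e k + e i) = wijk"
      using d by (simp_all add: w_def W_def)
    show "\<exists>w. w n = w0 \<and> w (n + e i) = wi \<and> w (n + e j) = wj \<and> w (n + e k) = wk \<and>
       (\<forall>(n', i', j') \<in> {(n, i, j), (n + e k, i, j), (n, j, k), (n + e i, j, k), (n, k, i), (n + e j, k, i)}.
          w (n' + e i' + e j') - w n' = coeff_matrix a b c n' i' j' *v (w (n' + e i') - w (n' + e j')))"
      by (rule exI[of _ w]) (simp add: w faces)
  qed
qed

section \<open>Spreading the relation from any corner of a cube\<close>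

definition pencil_cube where
  "pencil_cube l m v A B C A' B' C' \<longleftrightarrow>
     A \<in> pencil l m v \<and> B \<in> pencil l m v \<and> C \<in> pencil l m v \<and>
     A' \<in> pencil l (- m) v \<and> B' \<in> pencil l (- m) v \<and> C' \<in> pencil l (- m) v"

lemma pencil_cube_cyclic: "pencil_cube l m v B C A B' C' A' \<longleftrightarrow> pencil_cube l m v A B C A' B' C'"
  by (auto simp: pencil_cube_def)

definition invertible_cube where
  "invertible_cube A B C A' B' C' \<longleftrightarrow> cube_eqs A B C A' B' C' \<and>
     invertible A \<and> invertible B \<and> invertible C \<and> invertible A' \<and> invertible B' \<and> invertible C'"

lemma invertible_cube_cyclic: "invertible_cube A B C A' B' C' \<Longrightarrow> invertible_cube B C A B' C' A'"
  by (simp add: invertible_cube_def cube_eqs_cyclic)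

lemma invertible_pencil_inverse:
  fixes M :: "'a::field^2^2"
  assumes "invertible M"
  obtains I where "M ** I = mat 1" "invertible I" "\<And>l m v. M \<in> pencil l m v \<longleftrightarrow> I \<in> pencil l (- m) v"
proof -
  obtain I where I: "M ** I = mat 1" "I ** M = mat 1"
    using assms unfolding invertible_def by blast
  have "M \<in> pencil l m v \<longleftrightarrow> I \<in> pencil l (- m) v" for l m v
    using pencil_inverse[of M l m v I] pencil_inverse[of I l "- m" v M] I by auto
  then show ?thesis using that I unfolding invertible_def by blast
qed

text \<open>The symmetry moving the base to a neighbouring corner; \<open>m\<close> changes sign
  because the parity of the corner does.\<close>

lemma invertible_cube_reflect:
  fixes A :: "'a::field^2^2"
  assumes "invertible_cube A B C A' B' C'"
  obtains IA IC IA' IC' where "invertible_cube IA B' IC IA' B IC'"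
    "\<And>l m v. A \<in> pencil l m v \<longleftrightarrow> IA \<in> pencil l (- m) v"
    "\<And>l m v. C \<in> pencil l m v \<longleftrightarrow> IC \<in> pencil l (- m) v"
    "\<And>l m v. A' \<in> pencil l m v \<longleftrightarrow> IA' \<in> pencil l (- m) v"
    "\<And>l m v. C' \<in> pencil l m v \<longleftrightarrow> IC' \<in> pencil l (- m) v"
    "\<And>l m v. pencil_cube l m v A B C A' B' C' \<longleftrightarrow> pencil_cube l (- m) v IA B' IC IA' B IC'"
proof -
  have inv: "invertible A" "invertible B" "invertible C" "invertible A'" "invertible B'" "invertible C'"
    and eqs: "cube_eqs A B C A' B' C'"
    using assms by (auto simp: invertible_cube_def)
  obtain IA where IA: "A ** IA = mat 1" "invertible IA"
    "\<And>l m v. A \<in> pencil l m v \<longleftrightarrow> IA \<in> pencil l (- m) v"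
    using invertible_pencil_inverse[OF inv(1)] by blast
  obtain IC where IC: "C ** IC = mat 1" "invertible IC"
    "\<And>l m v. C \<in> pencil l m v \<longleftrightarrow> IC \<in> pencil l (- m) v"
    using invertible_pencil_inverse[OF inv(3)] by blast
  obtain IA' where IA': "A' ** IA' = mat 1" "invertible IA'"
    "\<And>l m v. A' \<in> pencil l m v \<longleftrightarrow> IA' \<in> pencil l (- m) v"
    using invertible_pencil_inverse[OF inv(4)] by blast
  obtain IC' where IC': "C' ** IC' = mat 1" "invertible IC'"
    "\<And>l m v. C' \<in> pencil l m v \<longleftrightarrow> IC' \<in> pencil l (- m) v"
    using invertible_pencil_inverse[OF inv(6)] by blast
  have "invertible_cube IA B' IC IA' B IC'"
    using cube_eqs_reflect[OF eqs IA(1) IC(1) IA'(1) IC'(1)] IA(2) IC(2) IA'(2) IC'(2) inv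
    by (simp add: invertible_cube_def)
  moreover have "pencil_cube l m v A B C A' B' C' \<longleftrightarrow> pencil_cube l (- m) v IA B' IC IA' B IC'" for l m v
    by (auto simp: pencil_cube_def IA(3) IC(3) IA'(3) IC'(3))
  ultimately show ?thesis using that IA(3) IC(3) IA'(3) IC'(3) by blast
qed

lemma pencil_cube_corner_0:
  assumes "(l, m, v) \<noteq> (0, 0, 0)" "invertible_cube A B C A' B' C'"
    "A \<in> pencil l m v" "B \<in> pencil l m v" "C \<in> pencil l m v"
  shows "pencil_cube l m v A B C A' B' C'"
  using assms cube_eqs_pencil[of l m v A B C A' B' C'] unfolding pencil_cube_def invertible_cube_def by blast

lemma pencil_cube_corner_1:
  fixes A :: "'a::field^2^2"
  assumes nz: "(l, m, v) \<noteq> (0, 0, 0)" and cube: "invertible_cube A B C A' B' C'"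
    and rel: "A \<in> pencil l m v" "B' \<in> pencil l (- m) v" "C \<in> pencil l m v"
  shows "pencil_cube l m v A B C A' B' C'"
proof -
  have nz': "(l, - m, v) \<noteq> (0, 0, 0)" using nz by simp
  obtain IA IC IA' IC' where R: "invertible_cube IA B' IC IA' B IC'"
    "\<And>l m v. A \<in> pencil l m v \<longleftrightarrow> IA \<in> pencil l (- m) v"
    "\<And>l m v. C \<in> pencil l m v \<longleftrightarrow> IC \<in> pencil l (- m) v"
    "\<And>l m v. pencil_cube l m v A B C A' B' C' \<longleftrightarrow> pencil_cube l (- m) v IA B' IC IA' B IC'"
    using invertible_cube_reflect[OF cube] by metis
  show ?thesis
    using pencil_cube_corner_0[OF nz' R(1)] rel unfolding R(2-) by blast
qed

text \<open>Reflection brings this corner next to the new base, and two cyclic rotations move the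
  one opposite plaquette to the middle position of \<open>pencil_cube_corner_1\<close>.\<close>

lemma pencil_cube_corner_2:
  fixes A :: "'a::field^2^2"
  assumes nz: "(l, m, v) \<noteq> (0, 0, 0)" and cube: "invertible_cube A B C A' B' C'"
    and rel: "A' \<in> pencil l (- m) v" "B' \<in> pencil l (- m) v" "C \<in> pencil l m v"
  shows "pencil_cube l m v A B C A' B' C'"
proof -
  have nz': "(l, - m, v) \<noteq> (0, 0, 0)" using nz by simp
  obtain IA IC IA' IC' where R: "invertible_cube IA B' IC IA' B IC'"
    "\<And>l m v. A' \<in> pencil l m v \<longleftrightarrow> IA' \<in> pencil l (- m) v"
    "\<And>l m v. C \<in> pencil l m v \<longleftrightarrow> IC \<in> pencil l (- m) v"
    "\<And>l m v. pencil_cube l m v A B C A' B' C' \<longleftrightarrow> pencil_cube l (- m) v IA B' IC IA' B IC'"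
    using invertible_cube_reflect[OF cube] by metis
  show ?thesis
    unfolding R(4)
    by (rule pencil_cube_cyclic[THEN iffD1, OF pencil_cube_cyclic[THEN iffD1]],
        rule pencil_cube_corner_1[OF nz' invertible_cube_cyclic[OF invertible_cube_cyclic[OF R(1)]]])
      (use rel R(2,3) in simp_all)
qed

lemma pencil_cube_corner_3:
  fixes A :: "'a::field^2^2"
  assumes nz: "(l, m, v) \<noteq> (0, 0, 0)" and cube: "invertible_cube A B C A' B' C'"
    and rel: "A' \<in> pencil l (- m) v" "B' \<in> pencil l (- m) v" "C' \<in> pencil l (- m) v"
  shows "pencil_cube l m v A B C A' B' C'"
proof -
  have nz': "(l, - m, v) \<noteq> (0, 0, 0)" using nz by simp
  obtain IA IC IA' IC' where R: "invertible_cube IA B' IC IA' B IC'"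
    "\<And>l m v. A' \<in> pencil l m v \<longleftrightarrow> IA' \<in> pencil l (- m) v"
    "\<And>l m v. C' \<in> pencil l m v \<longleftrightarrow> IC' \<in> pencil l (- m) v"
    "\<And>l m v. pencil_cube l m v A B C A' B' C' \<longleftrightarrow> pencil_cube l (- m) v IA B' IC IA' B IC'"
    using invertible_cube_reflect[OF cube] by metis
  show ?thesis
    unfolding R(4)
    by (rule pencil_cube_cyclic[THEN iffD1, OF pencil_cube_cyclic[THEN iffD1]],
        rule pencil_cube_corner_2[OF nz' invertible_cube_cyclic[OF invertible_cube_cyclic[OF R(1)]]])
      (use rel R(2,3) in simp_all)
qed

text \<open>Choosing one plaquette from each opposite pair is choosing a vertex of the cube. Up to
  cyclic rotation the eight vertices reduce to the four preceding cases.\<close>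

lemma pencil_cube_corner:
  fixes A :: "'a::field^2^2"
  assumes nz: "(l, m, v) \<noteq> (0, 0, 0)" and cube: "invertible_cube A B C A' B' C'"
    and rel: "A \<in> pencil l m v \<or> A' \<in> pencil l (- m) v" "B \<in> pencil l m v \<or> B' \<in> pencil l (- m) v"
      "C \<in> pencil l m v \<or> C' \<in> pencil l (- m) v"
  shows "pencil_cube l m v A B C A' B' C'"
proof -
  note cube2 = invertible_cube_cyclic[OF cube]
  note cube3 = invertible_cube_cyclic[OF cube2]
  note cyc2 = pencil_cube_cyclic[THEN iffD1]
  note cyc3 = cyc2[OF cyc2]
  note corner_1 = pencil_cube_corner_1[OF nz] and corner_2 = pencil_cube_corner_2[OF nz]
  show ?thesis
    using rel
  proof (elim disjE)
    assume "A \<in> pencil l m v" "B \<in> pencil l m v" "C \<in> pencil l m v"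
    then show ?thesis by (rule pencil_cube_corner_0[OF nz cube])
  next
    assume "A' \<in> pencil l (- m) v" "B' \<in> pencil l (- m) v" "C' \<in> pencil l (- m) v"
    then show ?thesis by (rule pencil_cube_corner_3[OF nz cube])
  qed (rule corner_1[OF cube] cyc2[OF corner_1[OF cube2]] cyc3[OF corner_1[OF cube3]]
      corner_2[OF cube] cyc2[OF corner_2[OF cube2]] cyc3[OF corner_2[OF cube3]]; assumption)+
qed

section \<open>Plaquette quantities, parity and roots\<close>

lemma opposite_pencil:
  "coeff_matrix a b c (n + e k) i j \<in> pencil l (- (m * parity_sign n)) v \<longleftrightarrow> lin_rel a b c l m v (n + e k) i j"
  by (simp add: lin_rel_iff_pencil parity_sign_add_e)

lemma lin_rel_cube_iff_pencil_cube:
  "lin_rel_cube a b c l m v n i j k \<longleftrightarrow>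
    pencil_cube l (m * parity_sign n) v
      (coeff_matrix a b c n i j) (coeff_matrix a b c n j k) (coeff_matrix a b c n k i)
      (coeff_matrix a b c (n + e k) i j) (coeff_matrix a b c (n + e i) j k) (coeff_matrix a b c (n + e j) k i)"
  by (auto simp: lin_rel_cube_def lin_rel_base_def pencil_cube_def opposite_pencil simp flip: lin_rel_iff_pencil)

lemma shifted_coeff_base:
  "shifted_coeff \<xi> a b n i j =
    coeff_matrix a b c n i j $ 1 $ 2 + parity_sign n * \<xi> * coeff_matrix a b c n i j $ 1 $ 1"
  by (simp add: shifted_coeff_def coeff_matrix_def)

lemma shifted_coeff_opposite:
  "shifted_coeff \<xi> a b (n + e k) i j =
    coeff_matrix a b c (n + e k) i j $ 1 $ 2 - parity_sign n * \<xi> * coeff_matrix a b c (n + e k) i j $ 1 $ 1"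
  by (simp add: shifted_coeff_def coeff_matrix_def parity_sign_add_e)

text \<open>The parity sign is absorbed into the roots: multiplying both by \<open>s\<close>
  multiplies their sum by \<open>s\<close> and leaves their product unchanged.\<close>

lemma pencil_cube_factors:
  assumes rel: "lin_rel_cube a b c l \<mu> v n i j k" and "l \<noteq> 0" and roots: "minus_roots l \<mu> v \<xi> \<eta>"
  defines "s \<equiv> parity_sign n"
  shows "pencil_cube l (l * (s * \<xi> + s * \<eta>)) (l * (s * \<xi>) * (s * \<eta>))
      (coeff_matrix a b c n i j) (coeff_matrix a b c n j k) (coeff_matrix a b c n k i)
      (coeff_matrix a b c (n + e k) i j) (coeff_matrix a b c (n + e i) j k) (coeff_matrix a b c (n + e j) k i)"
proof -
  have "s * s = 1" using parity_sign_cases[of n] unfolding s_def by auto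
  have \<mu>: "\<mu> * s = l * (s * \<xi> + s * \<eta>)"
    using roots by (simp add: minus_roots_iff[OF \<open>l \<noteq> 0\<close>] algebra_simps)
  have v: "l * (s * \<xi>) * (s * \<eta>) = v"
  proof -
    have "l * (s * \<xi>) * (s * \<eta>) = (s * s) * (l * \<xi> * \<eta>)" by simp
    also have "\<dots> = v"
      using roots \<open>s * s = 1\<close> by (simp add: minus_roots_iff[OF \<open>l \<noteq> 0\<close>])
    finally show ?thesis .
  qed
  show ?thesis
    using rel[unfolded lin_rel_cube_iff_pencil_cube, folded s_def] unfolding \<mu> v .
qed

lemma parity_product_of_roots:
  assumes "l \<noteq> 0" "minus_roots l \<mu> v \<xi> \<eta>"
  shows "(parity_sign n * \<xi>) * (parity_sign n * \<eta>) = v / l"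
  using assms(2) parity_sign_cases[of n] \<open>l \<noteq> 0\<close> by (auto simp: minus_roots_iff[OF \<open>l \<noteq> 0\<close>])

lemma cube_consistent_imp_star_products:
  assumes d: "distinct [i, j, k]" and rel: "lin_rel_cube a b c l \<mu> v n i j k"
    and l: "l \<noteq> 0" and roots: "minus_roots l \<mu> v \<xi> \<eta>" and cons: "cube_consistent a b c n i j k"
  defines "p \<equiv> shifted_coeff \<xi> a b" and "q \<equiv> shifted_coeff \<eta> a b"
  shows "star_products (v / l) (p (n + e k) i j) (p (n + e i) j k) (p (n + e j) k i) (q n i j) (q n j k) (q n k i)"
  using pencil_cube_factors[OF rel l roots, unfolded pencil_cube_def]
    cube_eqs_star_products[OF _ _ _ _ _ _ l cons[unfolded cube_consistent_iff[OF d]]]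
  unfolding p_def q_def shifted_coeff_opposite[where c=c] shifted_coeff_base[where c=c and n=n]
    parity_product_of_roots[OF l roots, of n, symmetric]
  by blast

lemma star_products_imp_cube_consistent:
  assumes d: "distinct [i, j, k]" and rel: "lin_rel_cube a b c l \<mu> v n i j k"
    and l: "l \<noteq> 0" and v: "v \<noteq> 0" and roots: "minus_roots l \<mu> v \<xi> \<eta>" and "\<xi> \<noteq> \<eta>"
  defines "p \<equiv> shifted_coeff \<xi> a b" and "q \<equiv> shifted_coeff \<eta> a b"
  assumes p: "star_products (v / l) (p (n + e k) i j) (p (n + e i) j k) (p (n + e j) k i) (q n i j) (q n j k) (q n k i)"
    and q: "star_products (v / l) (q (n + e k) i j) (q (n + e i) j k) (q (n + e j) k i) (p n i j) (p n j k) (p n k i)"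
  shows "cube_consistent a b c n i j k"
proof -
  have s: "parity_sign n \<noteq> 0" using parity_sign_cases[of n] by auto
  moreover have "\<xi> \<noteq> 0" "\<eta> \<noteq> 0" using roots v by (auto simp: minus_roots_iff[OF l])
  ultimately have nz: "parity_sign n * \<xi> \<noteq> 0" "parity_sign n * \<eta> \<noteq> 0" by simp_all
  have ne: "parity_sign n * \<xi> \<noteq> parity_sign n * \<eta>" using s \<open>\<xi> \<noteq> \<eta>\<close> by simp
  note star = p q
  note star = star[unfolded p_def q_def shifted_coeff_opposite[where c=c] shifted_coeff_base[where c=c and n=n]
      parity_product_of_roots[OF l roots, of n, symmetric]]
  show ?thesis
    unfolding cube_consistent_iff[OF d]
    using pencil_cube_factors[OF rel l roots, unfolded pencil_cube_def]
      star_products_cube_eqs[OF _ _ _ _ _ _ l nz ne star]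
    by blast
qed

lemma generic_roots_distinct:
  assumes "generic_triple l \<mu> v" "minus_roots l \<mu> v \<xi> \<eta>"
  shows "\<xi> \<noteq> \<eta>"
  using assms minus_roots_iff[of l \<mu> v \<xi> \<eta>] by (auto simp: generic_triple_def power2_eq_square)

lemma governed_imp_governed_cube:
  assumes "governed a b c l \<mu> v" "distinct [i, j, k]"
  shows "governed_cube a b c l \<mu> v n i j k"
proof -
  note gov = assms(1)[unfolded governed_def]
  note nz = conjunct1[OF gov] and lin = conjunct1[OF conjunct2[OF gov]] and star = conjunct2[OF conjunct2[OF gov]]
  have rel: "lin_rel_cube a b c l \<mu> v n i j k"
    using lin assms(2) not_sym[of i k] by (simp add: lin_rel_cube_def lin_rel_base_def)
  have ev: "\<exists>\<xi> \<eta>. minus_roots l \<mu> v \<xi> \<eta> \<and> evolves a b l v \<xi> \<eta> n i j k" if lv: "l \<noteq> 0 \<and> v \<noteq> 0"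
  proof -
    obtain \<xi> \<eta> where "minus_roots l \<mu> v \<xi> \<eta>"
      "\<forall>n i j k. distinct [i, j, k] \<longrightarrow> evolves a b l v \<xi> \<eta> n i j k"
      using mp[OF star lv] by blast
    then show ?thesis using assms(2) by metis
  qed
  show ?thesis
    unfolding governed_cube_def by (rule conjI[OF nz conjI[OF rel impI[OF ev]]])
qed

lemma governed_imp_generic_triple:
  assumes "generic_coeffs a b c" "governed a b c l \<mu> v"
  shows "generic_triple l \<mu> v"
proof -
  note gov = assms(2)[unfolded governed_def]
  show ?thesis
    by (rule assms(1)[unfolded generic_coeffs_def, THEN spec, THEN spec, THEN spec, THEN mp])
      (rule conjI[OF conjunct1[OF gov] conjunct1[OF conjunct2[OF gov]]])
qed

section \<open>The linear relation on the whole lattice\<close>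

locale nondegenerate_plaquettes =
  fixes a b c :: "'n::finite plaq"
  assumes nondegenerate: "\<And>n i j. i \<noteq> j \<Longrightarrow> invertible (coeff_matrix a b c n i j)"
begin

lemma lin_rel_corner:
  assumes d: "distinct [i, j, k]" and cons: "cube_consistent a b c n i j k" and nz: "(l, m, v) \<noteq> (0, 0, 0)"
    and rel: "lin_rel a b c l m v n i j \<or> lin_rel a b c l m v (n + e k) i j"
      "lin_rel a b c l m v n j k \<or> lin_rel a b c l m v (n + e i) j k"
      "lin_rel a b c l m v n k i \<or> lin_rel a b c l m v (n + e j) k i"
  shows "lin_rel_cube a b c l m v n i j k"
proof -
  have nz': "(l, m * parity_sign n, v) \<noteq> (0, 0, 0)"
    using nz parity_sign_cases[of n] by auto
  have d': "i \<noteq> j" "j \<noteq> k" "k \<noteq> i" using d by auto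
  have "invertible_cube
      (coeff_matrix a b c n i j) (coeff_matrix a b c n j k) (coeff_matrix a b c n k i)
      (coeff_matrix a b c (n + e k) i j) (coeff_matrix a b c (n + e i) j k) (coeff_matrix a b c (n + e j) k i)"
    using cons d' unfolding cube_consistent_iff[OF d] invertible_cube_def by (simp add: nondegenerate)
  from pencil_cube_corner[OF nz' this] rel show ?thesis
    unfolding lin_rel_cube_iff_pencil_cube lin_rel_iff_pencil[of a b c l m v n] opposite_pencil[symmetric]
    by blast
qed

lemma cube_consistent_imp_ex_lin_rel:
  assumes d: "distinct [i, j, k]" and cons: "cube_consistent a b c n i j k"
  obtains l m v where "(l, m, v) \<noteq> (0, 0, 0)" "lin_rel_base a b c l m v n i j k"
proof -
  have d': "i \<noteq> j" "j \<noteq> k" "k \<noteq> i" using d by auto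
  have diag: "coeff_matrix a b c n x y $ 1 $ 1 = coeff_matrix a b c n x y $ 2 $ 2" for x y
    by (simp add: coeff_matrix_def)
  obtain l m v where nz: "(l, m, v) \<noteq> (0, 0, 0)" and mem: "coeff_matrix a b c n i j \<in> pencil l m v"
    "coeff_matrix a b c n j k \<in> pencil l m v" "coeff_matrix a b c n k i \<in> pencil l m v"
    using cube_eqs_relation[OF cons[unfolded cube_consistent_iff[OF d]] nondegenerate[OF d'(1)]
      nondegenerate[OF d'(1)] diag diag diag] by blast
  \<comment> \<open>The pencil at \<open>n\<close> already contains the parity sign; a second factor
    removes it, since its square is 1.\<close>
  have m: "m * parity_sign n * parity_sign n = m"
    using parity_sign_cases[of n] by auto
  have "lin_rel_base a b c l (m * parity_sign n) v n i j k"
    unfolding lin_rel_base_def lin_rel_iff_pencil m using mem by blast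
  moreover have "(l, m * parity_sign n, v) \<noteq> (0, 0, 0)"
    using nz parity_sign_cases[of n] by auto
  ultimately show ?thesis by (rule that[rotated])
qed

lemma lin_rel_everywhere:
  assumes cons: "consistent a b c" and nz: "(l, \<mu>, v) \<noteq> (0, 0, 0)"
    and planes: "\<And>n i j. i \<noteq> j \<Longrightarrow> (\<And>l. l \<noteq> i \<Longrightarrow> l \<noteq> j \<Longrightarrow> n $ l = m $ l) \<Longrightarrow> lin_rel a b c l \<mu> v n i j"
    and "i \<noteq> j"
  shows "lin_rel a b c l \<mu> v n i j"
proof -
  \<comment> \<open>\<open>D n i j\<close> is twice the sum-norm distance from \<open>m\<close> to the centre of the plaquette. If the plaquette is not in a
    coordinate plane through \<open>m\<close>, it is a face of a cube with a corner whose three plaquettes are all closer to \<open>m\<close>.\<close>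
  define \<delta> where "\<delta> n i j q = nat \<bar>2 * (n $ q - m $ q) + (if q = i \<or> q = j then 1 else 0)\<bar>"
    for n :: "int^'n" and i j q :: 'n
  define D where "D n i j = sum (\<delta> n i j) UNIV" for n :: "int^'n" and i j :: 'n
  have D_less: "D n' i' j' < D n i j"
    if "\<And>q. q \<noteq> i \<Longrightarrow> q \<noteq> j \<Longrightarrow> q \<noteq> r \<Longrightarrow> \<delta> n' i' j' q \<le> \<delta> n i j q"
      "\<delta> n' i' j' i \<le> \<delta> n i j i" "\<delta> n' i' j' j \<le> \<delta> n i j j" "\<delta> n' i' j' r < \<delta> n i j r" for n' i' j' n i j r
  proof -
    have "\<delta> n' i' j' q \<le> \<delta> n i j q" for q
      using that by (cases "q = i \<or> q = j \<or> q = r") auto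
    then show ?thesis
      unfolding D_def using that(4) by (intro sum_strict_mono_ex1) auto
  qed
  show ?thesis
    using \<open>i \<noteq> j\<close>
  proof (induction "D n i j" arbitrary: n i j rule: less_induct)
    case less
    show ?case
    proof (cases "\<forall>q. q \<noteq> i \<and> q \<noteq> j \<longrightarrow> n $ q = m $ q")
      case True
      then show ?thesis using planes[OF less.prems] by blast
    next
      case False
      then obtain k where k: "k \<noteq> i" "k \<noteq> j" "n $ k \<noteq> m $ k" by blast
      \<comment> \<open>The cube extends from the plaquette towards \<open>m\<close> in direction
        \<open>k\<close>; \<open>x\<close> is the opposite face, while \<open>y\<close> and
        \<open>z\<close> take the nearer face of each remaining pair. A tie must go to
        \<open>n0\<close>: the other face would gain in direction \<open>i\<close> or
        \<open>j\<close> what is saved in direction \<open>k\<close>.\<close>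
      define n0 where "n0 = (if n $ k > m $ k then n - e k else n)"
      define x where "x = (if n $ k > m $ k then n0 else n0 + e k)"
      define y where "y = (if n $ i \<ge> m $ i then n0 else n0 + e i)"
      define z where "z = (if n $ j \<ge> m $ j then n0 else n0 + e j)"
      have ij: "i \<noteq> j" "j \<noteq> i" and ks: "i \<noteq> k" "j \<noteq> k" using less.prems k by auto
      note defs = \<delta>_def n0_def x_def y_def z_def
      have "D x i j < D n i j"
        by (rule D_less[where r=k and i=i and j=j]) (use ij k ks in \<open>auto simp: defs\<close>)
      then have x: "lin_rel a b c l \<mu> v x i j" using less.hyps ij(1) by blast
      have "D y j k < D n i j"
        by (rule D_less[where r=k and i=i and j=j]) (use ij k ks in \<open>auto simp: defs\<close>)
      then have y: "lin_rel a b c l \<mu> v y j k" using less.hyps ks(2) by blast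
      have "D z k i < D n i j"
        by (rule D_less[where r=k and i=i and j=j]) (use ij k ks in \<open>auto simp: defs\<close>)
      then have z: "lin_rel a b c l \<mu> v z k i" using less.hyps k(1) by blast
      have d: "distinct [i, j, k]" using ij k by auto
      have "x = n0 \<or> x = n0 + e k" "y = n0 \<or> y = n0 + e i" "z = n0 \<or> z = n0 + e j"
        by (simp_all add: x_def y_def z_def)
      moreover have "cube_consistent a b c n0 i j k"
        using cons d unfolding consistent_def by blast
      ultimately have "lin_rel_cube a b c l \<mu> v n0 i j k"
        using x y z by (intro lin_rel_corner[OF d _ nz]) metis+
      moreover have "n = n0 \<or> n = n0 + e k"
        by (simp add: n0_def)
      ultimately show ?thesis
        unfolding lin_rel_cube_def lin_rel_base_def by metis
    qed
  qed
qed

section \<open>Star-triangle evolution and consistency\<close>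

text \<open>Invertibility of the six matrices makes all p and q nonzero, so the denominators can be
  cleared by \<open>star_products_iff\<close>.\<close>

lemma evolves_iff_star_products:
  assumes d: "distinct [i, j, k]" and rel: "lin_rel_cube a b c l \<mu> v n i j k"
    and l: "l \<noteq> 0" and v: "v \<noteq> 0" and roots: "minus_roots l \<mu> v \<xi> \<eta>"
  defines "p \<equiv> shifted_coeff \<xi> a b" and "q \<equiv> shifted_coeff \<eta> a b"
  shows "evolves a b l v \<xi> \<eta> n i j k \<longleftrightarrow>
    star_products (v / l) (p (n + e k) i j) (p (n + e i) j k) (p (n + e j) k i) (q n i j) (q n j k) (q n k i) \<and>
    star_products (v / l) (q (n + e k) i j) (q (n + e i) j k) (q (n + e j) k i) (p n i j) (p n j k) (p n k i)"
proof -
  define s where "s = parity_sign n"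
  have d': "i \<noteq> j" "j \<noteq> k" "k \<noteq> i" using d by auto
  have "\<xi> \<noteq> 0" "\<eta> \<noteq> 0" using roots v by (auto simp: minus_roots_iff[OF l])
  moreover have "s \<noteq> 0" using parity_sign_cases[of n] by (auto simp: s_def)
  ultimately have nz: "s * \<xi> \<noteq> 0" "s * \<eta> \<noteq> 0" by simp_all
  note cube = pencil_cube_factors[OF rel l roots, folded s_def, unfolded pencil_cube_def]
  have base: "p n x y \<noteq> 0" "q n x y \<noteq> 0" if "(x, y) \<in> {(i, j), (j, k), (k, i)}" for x y
  proof -
    have "x \<noteq> y" using that d' by auto
    moreover have "coeff_matrix a b c n x y \<in> pencil l (l * (s * \<xi> + s * \<eta>)) (l * (s * \<xi>) * (s * \<eta>))"
      using that cube by auto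
    ultimately show "p n x y \<noteq> 0" "q n x y \<noteq> 0"
      using pencil_invertible_factors[OF _ l nz nondegenerate] unfolding p_def q_def shifted_coeff_base[where c=c] s_def by blast+
  qed
  \<comment> \<open>On opposite faces the nonvanishing lemma is applied with both roots
    negated.\<close>
  have opp: "p (n + e r) x y \<noteq> 0" "q (n + e r) x y \<noteq> 0" if "(x, y, r) \<in> {(i, j, k), (j, k, i), (k, i, j)}" for x y r
  proof -
    have "x \<noteq> y" using that d' by auto
    moreover have "coeff_matrix a b c (n + e r) x y \<in> pencil l (l * (- (s * \<xi>) + - (s * \<eta>))) (l * - (s * \<xi>) * - (s * \<eta>))"
      using that cube by (auto simp: algebra_simps)
    ultimately show "p (n + e r) x y \<noteq> 0" "q (n + e r) x y \<noteq> 0"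
      using pencil_invertible_factors[where \<xi> = "- (s * \<xi>)" and \<eta> = "- (s * \<eta>)", OF _ l _ _ nondegenerate] nz
      unfolding p_def q_def shifted_coeff_opposite[where c=c] s_def by fastforce+
  qed
  have "v / l \<noteq> 0" using l v by simp
  note star = star_products_iff[OF this]
  show ?thesis
    unfolding evolves_def coupled_star_triangle_def half_star_triangle_def
    by (simp add: star base opp p_def[symmetric] q_def[symmetric]) blast
qed

lemma governed_cube_imp_cube_consistent:
  assumes d: "distinct [i, j, k]" and gen: "generic_triple l \<mu> v" and gov: "governed_cube a b c l \<mu> v n i j k"
  shows "cube_consistent a b c n i j k"
proof -
  have nz: "l \<noteq> 0" "v \<noteq> 0" using gen by (auto simp: generic_triple_def)
  obtain \<xi> \<eta> where roots: "minus_roots l \<mu> v \<xi> \<eta>" and ev: "evolves a b l v \<xi> \<eta> n i j k"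
    and rel: "lin_rel_cube a b c l \<mu> v n i j k"
    using gov nz unfolding governed_cube_def by blast
  note star = ev[unfolded evolves_iff_star_products[OF d rel nz roots]]
  show ?thesis
    using star_products_imp_cube_consistent[OF d rel nz roots generic_roots_distinct[OF gen roots]] star by blast
qed

lemma cube_consistent_imp_evolves:
  assumes d: "distinct [i, j, k]" and rel: "lin_rel_cube a b c l \<mu> v n i j k"
    and nz: "l \<noteq> 0" "v \<noteq> 0" and roots: "minus_roots l \<mu> v \<xi> \<eta>" and cons: "cube_consistent a b c n i j k"
  shows "evolves a b l v \<xi> \<eta> n i j k"
proof -
  \<comment> \<open>The other half of the coupled system is the same statement with the roots
    exchanged.\<close>
  have swap: "minus_roots l \<mu> v \<eta> \<xi>"
    using roots by (simp add: minus_roots_def insert_commute)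
  show ?thesis
    unfolding evolves_iff_star_products[OF d rel nz roots]
    using cube_consistent_imp_star_products[OF d rel nz(1) roots cons]
      cube_consistent_imp_star_products[OF d rel nz(1) swap cons] by blast
qed

lemma cube_consistent_imp_governed_cube:
  assumes d: "distinct [i, j, k]" and cons: "cube_consistent a b c n i j k"
  shows "\<exists>l \<mu> v. governed_cube a b c l \<mu> v n i j k"
proof -
  obtain l \<mu> v where nz: "(l, \<mu>, v) \<noteq> (0, 0, 0)" and base: "lin_rel_base a b c l \<mu> v n i j k"
    using cube_consistent_imp_ex_lin_rel[OF d cons] by blast
  have rel: "lin_rel_cube a b c l \<mu> v n i j k"
    using lin_rel_corner[OF d cons nz] base unfolding lin_rel_base_def by blast
  have ev: "\<exists>\<xi> \<eta>. minus_roots l \<mu> v \<xi> \<eta> \<and> evolves a b l v \<xi> \<eta> n i j k" if lv: "l \<noteq> 0" "v \<noteq> 0"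
  proof -
    obtain \<xi> \<eta> where "minus_roots l \<mu> v \<xi> \<eta>"
      using minus_roots_exist[OF lv(1)] by blast
    with cube_consistent_imp_evolves[OF d rel lv _ cons] show ?thesis by blast
  qed
  have "governed_cube a b c l \<mu> v n i j k"
    unfolding governed_cube_def by (intro conjI impI nz rel; elim conjE) (rule ev)
  then show ?thesis by blast
qed

text \<open>One corner supplies the triple, the uniformity assumption carries it to the coordinate
  planes through \<open>m\<close>, and \<open>lin_rel_everywhere\<close> to all plaquettes.\<close>

lemma consistent_imp_governed:
  assumes d: "distinct [i0, j0, k0]" and init: "uniform_initial_data a b c m i0 j0 k0" and cons: "consistent a b c"
  shows "\<exists>l \<mu> v. governed a b c l \<mu> v"
proof -
  have "cube_consistent a b c m i0 j0 k0" using cons d unfolding consistent_def by blast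
  then obtain l \<mu> v where nz: "(l, \<mu>, v) \<noteq> (0, 0, 0)" and base: "lin_rel_base a b c l \<mu> v m i0 j0 k0"
    using cube_consistent_imp_ex_lin_rel[OF d] by blast
  have rel: "lin_rel a b c l \<mu> v n i j" if "i \<noteq> j" for n i j
  proof (rule lin_rel_everywhere[OF cons nz _ that])
    fix n i j
    assume "i \<noteq> j" "\<And>q. q \<noteq> i \<Longrightarrow> q \<noteq> j \<Longrightarrow> n $ q = m $ q"
    then show "lin_rel a b c l \<mu> v n i j"
      using init base unfolding uniform_initial_data_def by blast
  qed
  have ev: "\<exists>\<xi> \<eta>. minus_roots l \<mu> v \<xi> \<eta> \<and> (\<forall>n i j k. distinct [i, j, k] \<longrightarrow> evolves a b l v \<xi> \<eta> n i j k)"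
    if lv: "l \<noteq> 0" "v \<noteq> 0"
  proof -
    \<comment> \<open>The roots are fixed before any cube is considered, so the same \<xi> and
      \<eta> serve the whole lattice.\<close>
    obtain \<xi> \<eta> where roots: "minus_roots l \<mu> v \<xi> \<eta>"
      using minus_roots_exist[OF lv(1)] by blast
    have "evolves a b l v \<xi> \<eta> n i j k" if "distinct [i, j, k]" for n i j k
    proof (rule cube_consistent_imp_evolves[OF that _ lv roots])
      show "lin_rel_cube a b c l \<mu> v n i j k"
        using that not_sym[of i k] by (simp add: lin_rel_cube_def lin_rel_base_def rel)
      show "cube_consistent a b c n i j k"
        using cons that unfolding consistent_def by blast
    qed
    with roots show ?thesis by blast
  qed
  have "governed a b c l \<mu> v"
    unfolding governed_def
  proof (intro conjI impI nz)
    show "\<forall>n i j. i \<noteq> j \<longrightarrow> lin_rel a b c l \<mu> v n i j" by (simp add: rel)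
  qed (elim conjE, rule ev)
  then show ?thesis by blast
qed

lemma governed_imp_consistent:
  assumes "generic_triple l \<mu> v" "governed a b c l \<mu> v"
  shows "consistent a b c"
  using governed_cube_imp_cube_consistent[OF _ assms(1) governed_imp_governed_cube[OF assms(2)]]
  unfolding consistent_def by simp

end

theorem theorem7:
  fixes a b c :: "'n::finite plaq"
  assumes orientation: "\<And>n i j. i \<noteq> j \<Longrightarrow> coeff_matrix a b c n j i = - coeff_matrix a b c n i j"
    and nondegenerate: "\<And>n i j. i \<noteq> j \<Longrightarrow> invertible (coeff_matrix a b c n i j)"
  shows
    "(\<forall>m i0 j0 k0. distinct [i0, j0, k0] \<and> uniform_initial_data a b c m i0 j0 k0 \<longrightarrow>
        (generic_coeffs a b c \<longrightarrow>
           (consistent a b c \<longleftrightarrow> (\<exists>lam \<mu> \<nu>. governed a b c lam \<mu> \<nu>))) \<and>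
        (consistent a b c \<longrightarrow> (\<exists>lam \<mu> \<nu>. governed a b c lam \<mu> \<nu>))) \<and>
     (\<forall>lam \<mu> \<nu>. generic_triple lam \<mu> \<nu> \<and> governed a b c lam \<mu> \<nu> \<longrightarrow> consistent a b c) \<and>
     (\<forall>n i j k. distinct [i, j, k] \<longrightarrow>
        (cube_consistent a b c n i j k \<longrightarrow> (\<exists>lam \<mu> \<nu>. governed_cube a b c lam \<mu> \<nu> n i j k)) \<and>
        (\<forall>lam \<mu> \<nu>. generic_triple lam \<mu> \<nu> \<and> governed_cube a b c lam \<mu> \<nu> n i j k \<longrightarrow>
           cube_consistent a b c n i j k))"
proof -
  interpret nondegenerate_plaquettes a b c
    by unfold_locales (rule nondegenerate)
  have gov: "\<exists>lam \<mu> \<nu>. governed a b c lam \<mu> \<nu>"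
    if "distinct [i0, j0, k0] \<and> uniform_initial_data a b c m i0 j0 k0" "consistent a b c" for m i0 j0 k0
    using consistent_imp_governed that by blast
  \<comment> \<open>Genericity is demanded of every triple that the coefficients satisfy, in
    particular of the governing one.\<close>
  have "consistent a b c" if "generic_coeffs a b c" "\<exists>lam \<mu> \<nu>. governed a b c lam \<mu> \<nu>"
    using that governed_imp_generic_triple governed_imp_consistent by blast
  with gov have lattice: "(generic_coeffs a b c \<longrightarrow> (consistent a b c \<longleftrightarrow> (\<exists>lam \<mu> \<nu>. governed a b c lam \<mu> \<nu>))) \<and>
      (consistent a b c \<longrightarrow> (\<exists>lam \<mu> \<nu>. governed a b c lam \<mu> \<nu>))"
    if "distinct [i0, j0, k0] \<and> uniform_initial_data a b c m i0 j0 k0" for m i0 j0 k0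
    using that by meson
  have cube: "(cube_consistent a b c n i j k \<longrightarrow> (\<exists>lam \<mu> \<nu>. governed_cube a b c lam \<mu> \<nu> n i j k)) \<and>
      (\<forall>lam \<mu> \<nu>. generic_triple lam \<mu> \<nu> \<and> governed_cube a b c lam \<mu> \<nu> n i j k \<longrightarrow>
         cube_consistent a b c n i j k)" if "distinct [i, j, k]" for n i j k
    using cube_consistent_imp_governed_cube[OF that] governed_cube_imp_cube_consistent[OF that] by meson
  have "\<forall>lam \<mu> \<nu>. generic_triple lam \<mu> \<nu> \<and> governed a b c lam \<mu> \<nu> \<longrightarrow> consistent a b c"
    using governed_imp_consistent by blast
  then show ?thesis
    by (intro conjI) (intro allI impI, erule lattice cube | assumption)+
qed

end
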